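(* Let $\mathscr{A}$ denote the asymptotic density of the set of positive integers $m$ satisfying $\gcd(m,\sigma(m^2)) = \gcd(m^2,\sigma(m^2))$. Then $\mathscr{A} < 1$.
   Context: $\sigma(x)$ denotes the sum of the positive divisors of $x$. The asymptotic density of a set $S$ of positive integers is $\lim_{X\to\infty} \#\{m \le X : m \in S\}/X$. *)

theory Defs
  imports Complex_Main
begin

definition divisor_sigma :: "nat \<Rightarrow> nat" where
  "divisor_sigma n = (\<Sum>d | d dvd n. d)"

(* A relation rather than a function, since the limit need not exist for a general set. *)
definition has_asymptotic_density :: "nat set \<Rightarrow> real \<Rightarrow> bool" where
  "has_asymptotic_density S d \<longleftrightarrow>
     (\<lambda>X::nat. real (card {m \<in> S. 1 \<le> m \<and> m \<le> X}) / real X) \<longlonglongrightarrow> d"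

end

theory Submission
  imports Defs
    "HOL-Number_Theory.Prime_Powers"
    "HOL-Number_Theory.Residue_Primitive_Roots"
    "HOL-Computational_Algebra.Squarefree"
begin

text \<open>Dirichlet's theorem is needed with divergent reciprocal sums, so it is proved in the
  form of Mertens: the sum of \<open>mangoldt n / n\<close> over n \<le> x in a residue class mod p
  is at least ln x / (p - 1) - O(1). Only prime moduli occur (p and 3), so all characters come
  explicitly from a primitive root. Complex analysis is avoided: bounded partial sums of
  nonprincipal characters and summation by parts do the work, and the delicate point is that L(1,
  chi) does not vanish. The sieve uses only finitely many primes at a time. For finite Q, the
  numbers with no exact divisor in Q are counted by a product times X up to O(1), and divergence
  makes the product as small as desired. Hence, given an \<epsilon>, a finite set of p is fixed
  first and then, for each p, two disjoint finite sets of q; no uniformity in p is required.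
  Arbitrarily small upper bounds also give the existence of the limit.\<close>

text \<open>The density is in fact 0. If \<open>p\<close> is a prime with \<open>p \<equiv> 1 (mod 3)\<close>, choose \<open>w\<close> with
  \<open>w\<^sup>2 + w + 1 \<equiv> 0 (mod p)\<close>. A prime \<open>q \<equiv> w (mod p)\<close> that divides \<open>m\<close> exactly once contributes the
  factor \<open>\<sigma>(q\<^sup>2) = q\<^sup>2 + q + 1\<close> to \<open>\<sigma>(m\<^sup>2)\<close>, and \<open>p\<close> divides it. By Dirichlet's theorem
  the sum of \<open>1 / q\<close> over these \<open>q\<close> diverges, so a sieve shows that almost all \<open>m\<close> have two such prime factors.
  Then \<open>p\<^sup>2\<close> divides \<open>\<sigma>(m\<^sup>2)\<close>, and the two gcds differ whenever \<open>p\<close> divides \<open>m\<close> exactly once.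
  As the sum of \<open>1 / p\<close> over \<open>p \<equiv> 1 (mod 3)\<close> diverges too, almost all \<open>m\<close> have such a factor \<open>p\<close>.\<close>

section \<open>Sums over divisors\<close>

text \<open>Every divisor of \<open>m * n\<close> factors uniquely through the coprime factors. The
  product rule is asked only on these divisors because \<open>moebius_mu\<close> obeys it only at
  coprime arguments.\<close>

lemma sum_divisors_mult_coprime:
  fixes f g :: "nat \<Rightarrow> 'a::comm_semiring_0"
  assumes "coprime m n" "m > 0" "n > 0"
  assumes f: "\<And>d e. d dvd m \<Longrightarrow> e dvd n \<Longrightarrow> f (d * e) = g d * h e"
  shows "(\<Sum>d | d dvd m * n. f d) = (\<Sum>d | d dvd m. g d) * (\<Sum>e | e dvd n. h e)"
proof -
  have inj: "inj_on (\<lambda>(d, e). d * e) ({d. d dvd m} \<times> {e. e dvd n})"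
  proof (rule inj_onI, clarify)
    fix d e d' e' assume *: "d dvd m" "e dvd n" "d' dvd m" "e' dvd n" "d * e = d' * e'"
    have "coprime d e'" "coprime d' e" "coprime d e" "coprime d' e'"
      using * \<open>coprime m n\<close> by (meson coprime_divisors)+
    with \<open>d * e = d' * e'\<close> have "d dvd d'" "d' dvd d"
      by (metis coprime_dvd_mult_left_iff dvd_triv_left)+
    then have "d = d'" by (simp add: dvd_antisym)
    moreover have "d > 0" using * \<open>m > 0\<close> by (metis dvd_pos_nat)
    ultimately show "d = d' \<and> e = e'" using * by auto
  qed
  have "{d. d dvd m * n} = (\<lambda>(d, e). d * e) ` ({d. d dvd m} \<times> {e. e dvd n})"
  proof safe
    fix d assume "d dvd m * n"
    from division_decomp[OF this] obtain b c where "d = b * c" "b dvd m" "c dvd n" by blast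
    then show "d \<in> (\<lambda>(d, e). d * e) ` ({d. d dvd m} \<times> {e. e dvd n})" by auto
  qed (auto intro: mult_dvd_mono)
  then have "(\<Sum>d | d dvd m * n. f d) = (\<Sum>(d, e) \<in> {d. d dvd m} \<times> {e. e dvd n}. f (d * e))"
    by (simp only: sum.reindex[OF inj]) (simp add: case_prod_unfold comp_def)
  also have "\<dots> = (\<Sum>(d, e) \<in> {d. d dvd m} \<times> {e. e dvd n}. g d * h e)"
    by (intro sum.cong) (auto simp: f)
  also have "\<dots> = (\<Sum>d | d dvd m. g d) * (\<Sum>e | e dvd n. h e)"
    by (simp add: sum_product sum.cartesian_product)
  finally show ?thesis .
qed

lemma divisors_prime_power: "prime (p::nat) \<Longrightarrow> {d. d dvd p ^ k} = (\<lambda>i. p ^ i) ` {..k}"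
  by (simp add: set_eq_iff divides_primepow_nat image_iff Bex_def)

lemma sum_divisors_prime_power:
  fixes p :: nat
  assumes "prime p"
  shows "(\<Sum>d | d dvd p ^ k. f d) = (\<Sum>i\<le>k. f (p ^ i))"
proof -
  have "inj_on (\<lambda>i. p ^ i) {..k}"
    using prime_gt_1_nat[OF assms] by (auto intro!: inj_onI)
  then show ?thesis by (simp add: divisors_prime_power[OF assms] sum.reindex)
qed

text \<open>Suited to multiplicative functions: the full power of one prime is split off at once, so
  the cofactor is coprime to it.\<close>

lemma prime_power_coprime_induct [consumes 1, case_names one step]:
  fixes P :: "nat \<Rightarrow> bool"
  assumes "n > 0" "P 1"
    and step: "\<And>p k m. prime p \<Longrightarrow> k > 0 \<Longrightarrow> m > 0 \<Longrightarrow> coprime p m \<Longrightarrow> P m \<Longrightarrow> P (p ^ k * m)"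
  shows "P n"
  using assms(1)
proof (induction n rule: less_induct)
  case (less n)
  show ?case
  proof (cases "n = 1")
    case False
    then obtain p where p: "prime p" "p dvd n" using prime_factor_nat by blast
    have "n \<noteq> 0" "\<not> is_unit p" using less.prems p by auto
    then obtain m where m: "n = p ^ multiplicity p n * m" "\<not> p dvd m"
      by (rule multiplicity_decompose')
    have k: "multiplicity p n > 0" using p less.prems by (simp add: prime_multiplicity_gt_zero_iff)
    have m0: "m > 0" using m less.prems by (metis dvd_0_right gr0I)
    have "p ^ multiplicity p n > 1" using k prime_gt_1_nat[OF p(1)] by (metis one_less_power)
    then have "m < n" using m(1) m0 by (metis mult_less_cancel2 nat_mult_1)
    then have "P m" using less.IH m0 by blast
    moreover have "coprime p m" using m p prime_imp_coprime by blast
    ultimately have "P (p ^ multiplicity p n * m)" using step[OF p(1) k m0] by blast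
    then show ?thesis using m(1) by simp
  qed (use assms in simp)
qed

text \<open>Substitution \<open>n = d * k\<close>. The same swap serves ln x!, the twisted Mertens
  sums and the Lambert series.\<close>

lemma sum_divisors_swap:
  fixes f :: "nat \<Rightarrow> nat \<Rightarrow> 'a::comm_monoid_add"
  shows "(\<Sum>n=1..x. \<Sum>d | d dvd n. f d (n div d)) = (\<Sum>d=1..x. \<Sum>k=1..x div d. f d k)"
proof -
  have "(\<Sum>n=1..x. \<Sum>d | d dvd n. f d (n div d)) =
      (\<Sum>(n, d) \<in> (SIGMA n:{1..x}. {d. d dvd n}). f d (n div d))"
    by (rule sum.Sigma) auto
  also have "\<dots> = (\<Sum>(d, k) \<in> (SIGMA d:{1..x}. {1..x div d}). f d k)"
  proof (rule sum.reindex_bij_witness[of _ "\<lambda>(d, k). (d * k, d)" "\<lambda>(n, d). (d, n div d)"])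
    fix a assume "a \<in> (SIGMA n:{1..x}. {d. d dvd n})"
    then obtain d k where a: "a = (d * k, d)" "1 \<le> d * k" "d * k \<le> x" by (auto elim!: dvdE)
    then have "d \<ge> 1" "k \<ge> 1" "d \<le> d * k" by (auto simp: Suc_le_eq)
    moreover have "k \<le> x div d" using a \<open>d \<ge> 1\<close>
      by (metis div_le_mono nonzero_mult_div_cancel_left not_one_le_zero)
    ultimately show "(\<lambda>(n, d). (d, n div d)) a \<in> (SIGMA d:{1..x}. {1..x div d})"
      using a le_trans[OF \<open>d \<le> d * k\<close>] by auto
  next
    fix b assume "b \<in> (SIGMA d:{1..x}. {1..x div d})"
    then obtain d k where b: "b = (d, k)" "d \<in> {1..x}" "1 \<le> k" "k \<le> x div d" by auto
    then have "d * k \<le> d * (x div d)" by simp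
    then have "d * k \<le> x" using times_div_less_eq_dividend le_trans by blast
    then show "(\<lambda>(d, k). (d * k, d)) b \<in> (SIGMA n:{1..x}. {d. d dvd n})"
      using b by (auto simp: Suc_le_eq)
  qed auto
  also have "\<dots> = (\<Sum>d=1..x. \<Sum>k=1..x div d. f d k)"
    by (rule sum.Sigma[symmetric]) auto
  finally show ?thesis .
qed

lemma divisor_sigma_mult_coprime:
  "coprime m n \<Longrightarrow> m > 0 \<Longrightarrow> n > 0 \<Longrightarrow> divisor_sigma (m * n) = divisor_sigma m * divisor_sigma n"
  unfolding divisor_sigma_def by (rule sum_divisors_mult_coprime[where f = id and g = id and h = id, simplified])

section \<open>The Moebius function and inversion of the logarithm\<close>

definition moebius_mu :: "nat \<Rightarrow> real" where
  "moebius_mu n = (if squarefree n then (- 1) ^ card (prime_factors n) else 0)"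

lemma abs_moebius_mu_le: "\<bar>moebius_mu n\<bar> \<le> 1"
  by (simp add: moebius_mu_def power_abs)

lemma moebius_mu_1 [simp]: "moebius_mu (Suc 0) = 1"
  by (simp add: moebius_mu_def)

lemma moebius_mu_mult_coprime:
  assumes "coprime m n" "m > 0" "n > 0"
  shows "moebius_mu (m * n) = moebius_mu m * moebius_mu n"
proof -
  have "prime_factors m \<inter> prime_factors n = {}"
    using assms by (meson coprime_common_divisor disjoint_iff in_prime_factors_iff not_prime_unit)
  then have "card (prime_factors (m * n)) = card (prime_factors m) + card (prime_factors n)"
    using assms by (simp add: prime_factors_product card_Un_disjoint)
  then show ?thesis using assms
    by (auto simp: moebius_mu_def power_add squarefree_mult_coprime dest: squarefree_multD)
qed

lemma moebius_mu_prime_power: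
  "prime p \<Longrightarrow> moebius_mu (p ^ k) = (if k = 0 then 1 else if k = 1 then -1 else 0)"
  by (simp add: moebius_mu_def squarefree_power_iff squarefree_prime prime_factors_power prime_prime_factors)
     auto

text \<open>In the local factor of a prime only the exponents 0 and 1 contribute, and 1 - 1 = 0; one
  prime factor therefore kills the whole sum.\<close>

lemma sum_moebius_mu:
  assumes "n > 0"
  shows "(\<Sum>d | d dvd n. moebius_mu d) = (if n = 1 then 1 else 0)"
  using assms
proof (induction n rule: prime_power_coprime_induct)
  case (step p k m)
  have "(\<Sum>d | d dvd p ^ k * m. moebius_mu d) =
      (\<Sum>d | d dvd p ^ k. moebius_mu d) * (\<Sum>d | d dvd m. moebius_mu d)"
    using step prime_gt_0_nat[of p]
    by (intro sum_divisors_mult_coprime moebius_mu_mult_coprime)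
       (auto intro: dvd_pos_nat[of "p ^ k"] dvd_pos_nat[of m] coprime_divisors[of _ "p ^ k" _ m])
  also have "(\<Sum>d | d dvd p ^ k. moebius_mu d) = 0"
  proof -
    have "(\<Sum>i\<le>k. moebius_mu (p ^ i)) = (\<Sum>i\<in>{0, 1}. moebius_mu (p ^ i))"
      using step by (intro sum.mono_neutral_right) (auto simp: moebius_mu_prime_power)
    then show ?thesis
      using moebius_mu_prime_power[OF step(1), of 1] by (simp add: sum_divisors_prime_power step)
  qed
  finally show ?case using step(1,2) prime_gt_1_nat[of p] by auto
qed auto

text \<open>Moebius inversion of ln n = sum of \<open>mangoldt\<close> over divisors. After
  exchanging \<open>d\<close> and \<open>e\<close>, the inner sum over divisors of
  \<open>n div e\<close> vanishes unless \<open>e = n\<close>.\<close>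

lemma sum_moebius_mu_ln:
  assumes "n > 0"
  shows "(\<Sum>d | d dvd n. moebius_mu d * ln (real (n div d))) = mangoldt n"
proof -
  have fin: "finite {e. e dvd m}" if "m dvd n" for m using assms that by (auto intro: dvd_pos_nat)
  have iff: "d dvd n \<and> e dvd n div d \<longleftrightarrow> e dvd n \<and> d dvd n div e" for d e
  proof -
    have *: "d dvd n \<and> e dvd n div d \<longleftrightarrow> d * e dvd n" for d e
      using assms by (cases "d = 0") (auto simp: dvd_div_iff_mult mult.commute dest: dvd_mult_left)
    show ?thesis by (simp only: * mult.commute)
  qed
  have "(\<Sum>d | d dvd n. moebius_mu d * ln (real (n div d))) =
      (\<Sum>d | d dvd n. \<Sum>e | e dvd n div d. moebius_mu d * mangoldt e)"
    using assms by (intro sum.cong refl)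
      (auto simp: mangoldt_sum sum_distrib_left[symmetric] dvd_div_eq_0_iff)
  also have "\<dots> = (\<Sum>(d, e) \<in> (SIGMA d:{d. d dvd n}. {e. e dvd n div d}). moebius_mu d * mangoldt e)"
    using assms by (intro sum.Sigma) (auto simp: fin dvd_div_eq_0_iff)
  also have "\<dots> = (\<Sum>(e, d) \<in> (SIGMA e:{e. e dvd n}. {d. d dvd n div e}). moebius_mu d * mangoldt e)"
    by (rule sum.reindex_bij_witness[of _ prod.swap prod.swap]) (use iff in auto)
  also have "\<dots> = (\<Sum>e | e dvd n. \<Sum>d | d dvd n div e. moebius_mu d * mangoldt e)"
    using assms by (intro sum.Sigma[symmetric]) (auto simp: fin dvd_div_eq_0_iff)
  also have "\<dots> = (\<Sum>e | e dvd n. if e = n then mangoldt e else 0)"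
    using assms by (intro sum.cong refl)
     (auto simp: sum_distrib_right[symmetric] sum_moebius_mu dvd_div_eq_0_iff elim!: dvdE)
  also have "\<dots> = mangoldt n" using assms by simp
  finally show ?thesis .
qed

section \<open>Chebyshev and Mertens bounds\<close>

text \<open>Legendre's formula for ln x!, the source of both the Chebyshev and the Mertens
  bound.\<close>

lemma sum_ln_eq_sum_mangoldt:
  "(\<Sum>n=1..x. ln (real n)) = (\<Sum>d=1..x. mangoldt d * real (x div d))"
proof -
  have "(\<Sum>n=1..x. ln (real n)) = (\<Sum>n=1..x. \<Sum>d | d dvd n. mangoldt d)"
    by (intro sum.cong refl) (simp add: mangoldt_sum)
  also have "\<dots> = (\<Sum>d=1..x. \<Sum>k=1..x div d. mangoldt d)"
    by (rule sum_divisors_swap)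
  finally show ?thesis by (simp add: mult.commute)
qed

lemma sum_ln_upper: "(\<Sum>n=1..x. ln (real n)) \<le> x * ln (real x)"
proof -
  have "(\<Sum>n=1..x. ln (real n)) \<le> of_nat (card {1..x}) * ln (real x)"
    by (intro sum_bounded_above) auto
  then show ?thesis by simp
qed

text \<open>Crude Stirling bound; the induction step needs only x (ln (x + 1) - ln x) \<le>
  1.\<close>

lemma sum_ln_lower: "(\<Sum>n=1..x. ln (real n)) \<ge> x * ln (real x) - x"
proof (induction x)
  case (Suc x)
  show ?case
  proof (cases "x = 0")
    case False
    have "ln (real (Suc x)) - ln (real x) = ln (real (Suc x) / real x)"
      using False by (subst ln_div) auto
    also have "real (Suc x) / real x = 1 + 1 / real x" using False by (simp add: field_simps)
    finally have "x * (ln (real (Suc x)) - ln (real x)) = x * ln (1 + 1 / real x)" by simp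
    also have "\<dots> \<le> x * (1 / real x)"
      using False by (intro mult_left_mono ln_add_one_self_le_self) auto
    also have "\<dots> = 1" using False by simp
    finally show ?thesis using Suc by (simp add: algebra_simps)
  qed auto
qed auto

definition chebyshev_psi :: "nat \<Rightarrow> real" where
  "chebyshev_psi x = (\<Sum>d=1..x. mangoldt d)"

text \<open>This is the coefficient of \<open>mangoldt d\<close> in ln x! - 2 ln (x div 2)!, bounded
  below by the indicator of the upper half.\<close>

lemma div_half_diff:
  fixes x d :: nat assumes "d > 0"
  shows "real (x div d) - 2 * real (x div 2 div d) \<ge> (if x div 2 < d \<and> d \<le> x then 1 else 0)"
proof (cases "x div 2 < d \<and> d \<le> x")
  case True
  then have "x div 2 div d = 0" "x div d \<ge> 1" using assms by (auto simp: Suc_le_eq div_greater_zero_iff)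
  then show ?thesis using True by simp
next
  case False
  have "x div 2 div d = x div d div 2" by (metis div_mult2_eq mult.commute)
  then have "2 * (x div 2 div d) \<le> x div d" by simp
  then have "2 * real (x div 2 div d) \<le> real (x div d)"
    by (metis of_nat_le_iff of_nat_mult of_nat_numeral)
  then show ?thesis unfolding if_not_P[OF False] by simp
qed

text \<open>Chebyshev's central binomial argument. With k = x div 2, the crude Stirling bounds leave
  at most 6 k \<le> 3 x.\<close>

lemma chebyshev_psi_half: "chebyshev_psi x - chebyshev_psi (x div 2) \<le> 3 * real x"
proof -
  define T where "T = (\<lambda>x. \<Sum>n=1..x. ln (real n))"
  define k where "k = x div 2"
  have kx: "k \<le> x" by (simp add: k_def)
  have T1: "T x = (\<Sum>d=1..x. mangoldt d * real (x div d))"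
    unfolding T_def by (rule sum_ln_eq_sum_mangoldt)
  have T2: "T k = (\<Sum>d=1..x. mangoldt d * real (k div d))"
    unfolding T_def sum_ln_eq_sum_mangoldt using kx by (intro sum.mono_neutral_left) auto
  have psi: "chebyshev_psi k = (\<Sum>d=1..x. mangoldt d * (if d \<le> k then 1 else 0))"
    unfolding chebyshev_psi_def using kx by (intro sum.mono_neutral_cong_left) auto
  have "chebyshev_psi x - chebyshev_psi k = (\<Sum>d=1..x. mangoldt d * (if k < d \<and> d \<le> x then 1 else 0))"
    unfolding psi unfolding chebyshev_psi_def sum_subtractf[symmetric] by (intro sum.cong) auto
  also have "\<dots> \<le> (\<Sum>d=1..x. mangoldt d * (real (x div d) - 2 * real (k div d)))"
    unfolding k_def by (intro sum_mono mult_left_mono div_half_diff mangoldt_nonneg) auto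
  also have "\<dots> = T x - 2 * T k"
    unfolding T1 T2 by (simp add: right_diff_distrib sum_subtractf sum_distrib_left mult_ac)
  also have "\<dots> \<le> 3 * real x"
  proof (cases "k = 0")
    case True
    then have "x = 0 \<or> x = 1" by (auto simp: k_def)
    then show ?thesis using True by (auto simp: T_def)
  next
    case False
    \<comment> \<open>Covers both parities of \<open>x\<close>; for even \<open>x\<close> the added
      logarithm is merely nonnegative.\<close>
    have "T x \<le> T (2 * k) + ln (real (2 * k + 1))"
    proof -
      have "x = 2 * k \<or> x = Suc (2 * k)" by (auto simp: k_def)
      then show ?thesis by (auto simp: T_def)
    qed
    also have "\<dots> \<le> (2 * k) * ln (real (2 * k)) + 2 * k"
      using sum_ln_upper[of "2 * k"] ln_add_one_self_le_self[of "real (2 * k)"]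
      by (simp add: T_def add.commute)
    also have "ln (real (2 * k)) = ln 2 + ln k" using False by (simp add: ln_mult)
    finally have "T x \<le> (2 * real k) * (ln 2 + ln (real k)) + 2 * k" by simp
    also have "(2 * real k) * (ln 2 + ln (real k)) \<le> (2 * real k) * (1 + ln (real k))"
      using ln_add_one_self_le_self[of 1] by (intro mult_left_mono) auto
    finally have "T x \<le> 2 * k * (1 + ln k) + 2 * k" by simp
    moreover have "T k \<ge> k * ln (real k) - k" unfolding T_def by (rule sum_ln_lower)
    ultimately have "T x - 2 * T k \<le> 6 * real k" by (simp add: algebra_simps)
    also have "6 * real k \<le> 3 * real x" by (simp add: k_def)
    finally show ?thesis .
  qed
  finally show ?thesis by (simp add: k_def)
qed

text \<open>Repeated halving sums 3 (1 + 1/2 + 1/4 + ...) = 6.\<close>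

lemma chebyshev_psi_le: "chebyshev_psi x \<le> 6 * real x"
proof (induction x rule: less_induct)
  case (less x)
  show ?case
  proof (cases "x = 0")
    case False
    then have "chebyshev_psi (x div 2) \<le> 6 * real (x div 2)" by (intro less) auto
    also have "\<dots> \<le> 3 * real x" by simp
    finally show ?thesis using chebyshev_psi_half[of x] by simp
  qed (simp add: chebyshev_psi_def)
qed

text \<open>Mertens: in Legendre's formula, replacing \<open>x div d\<close> by x / d costs at most
  \<open>chebyshev_psi x\<close>, whence the constant 6.\<close>

lemma sum_mangoldt_over:
  assumes "x \<ge> 1"
  shows "\<bar>(\<Sum>d=1..x. mangoldt d / d) - ln (real x)\<bar> \<le> 6"
proof -
  let ?M = "\<Sum>d=1..x. mangoldt d / real d :: real" and ?T = "\<Sum>n=1..x. ln (real n)"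
  have eq: "x * ?M = (\<Sum>d=1..x. mangoldt d * (real x / real d))"
    by (simp add: sum_distrib_left mult_ac)
  have up: "?T \<le> x * ?M"
    unfolding eq sum_ln_eq_sum_mangoldt
    by (intro sum_mono mult_left_mono mangoldt_nonneg) (auto simp: of_nat_div_le_of_nat)
  have "x * ?M \<le> (\<Sum>d=1..x. mangoldt d * (real (x div d) + 1))"
    unfolding eq
  proof (intro sum_mono mult_left_mono mangoldt_nonneg)
    fix d assume "d \<in> {1..x}"
    then have "x < (x div d + 1) * d" using dividend_less_div_times[of d x] by simp
    then have "real x < (real (x div d) + 1) * real d"
      by (metis of_nat_less_iff of_nat_mult of_nat_add of_nat_1)
    then show "real x / real d \<le> real (x div d) + 1"
      using \<open>d \<in> {1..x}\<close> by (simp add: pos_divide_le_eq)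
  qed
  also have "\<dots> = ?T + chebyshev_psi x"
    unfolding sum_ln_eq_sum_mangoldt chebyshev_psi_def by (simp add: algebra_simps sum.distrib)
  finally have lo: "x * ?M \<le> ?T + 6 * x" using chebyshev_psi_le[of x] by simp
  have "x * (?M - ln x) \<le> x * 6" using lo sum_ln_upper[of x] by (simp add: algebra_simps)
  moreover have "x * (- 1) \<le> x * (?M - ln x)" using up sum_ln_lower[of x] by (simp add: algebra_simps)
  ultimately have "?M - ln x \<le> 6" "- 1 \<le> ?M - ln x"
    using assms by (auto intro: mult_left_le_imp_le[of "real x"])
  then show ?thesis by linarith
qed

lemma sum_ln_over_square: "(\<Sum>q=2..x. ln (real q) / (q * (q - 1))) \<le> 2"
proof (cases "x = 0")
  case False
  \<comment> \<open>Strengthened so as to telescope: each term is at most the drop of (ln q + 2) / q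
    from q - 1 to q, and this function has value 2 at 1. The added 2 pays for q (ln q - ln (q - 1))
    \<le> 2.\<close>
  have "(\<Sum>q=2..Suc n. ln (real q) / (real q * (real q - 1))) \<le> 2 - (ln (real (Suc n)) + 2) / real (Suc n)" for n
  proof (induction n)
    case (Suc n)
    define q where "q = real (Suc (Suc n))"
    have q: "q \<ge> 2" by (simp add: q_def)
    have "ln q - ln (q - 1) = ln (q / (q - 1))" using q by (subst ln_div) auto
    also have "q / (q - 1) = 1 + 1 / (q - 1)" using q by (simp add: field_simps)
    also have "ln (1 + 1 / (q - 1)) \<le> 1 / (q - 1)" using q by (intro ln_add_one_self_le_self) auto
    finally have "q * (ln q - ln (q - 1)) \<le> q * (1 / (q - 1))" using q by (intro mult_left_mono) auto
    also have "\<dots> \<le> 2" using q by (simp add: field_simps)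
    finally have "ln q / (q * (q - 1)) \<le> ((ln (q - 1) + 2) * q - (ln q + 2) * (q - 1)) / (q * (q - 1))"
      using q by (intro divide_right_mono) (auto simp: algebra_simps)
    also have "\<dots> = (ln (q - 1) + 2) / (q - 1) - (ln q + 2) / q"
      using q by (simp add: field_simps)
    finally have "ln q / (q * (q - 1)) \<le> (ln (q - 1) + 2) / (q - 1) - (ln q + 2) / q" .
    moreover have "q - 1 = real (Suc n)" by (simp add: q_def)
    ultimately show ?case using Suc by (simp add: q_def)
  qed auto
  from this[of "x - 1"] False have "(\<Sum>q=2..x. ln (real q) / (real q * (real q - 1))) \<le> 2 - (ln (real x) + 2) / real x"
    by simp
  also have "\<dots> \<le> 2" using False by simp
  also have "(\<Sum>q=2..x. ln (real q) / (real q * (real q - 1))) = (\<Sum>q=2..x. ln (real q) / (q * (q - 1)))"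
    by (intro sum.cong) (auto simp: of_nat_diff)
  finally show ?thesis .
qed auto

text \<open>Only powers q^k with k \<ge> 2 count, and for each q a geometric series bounds them by
  ln q / (q (q - 1)). Prime powers can thus be traded for primes at bounded cost.\<close>

lemma sum_mangoldt_nonprime:
  "(\<Sum>n \<in> {n \<in> {1..x}. \<not> prime n}. mangoldt n / n) \<le> (2::real)"
proof -
  let ?f = "\<lambda>n::nat. mangoldt n / n :: real"
  let ?A = "{q \<in> {2..x}. prime q} \<times> {2..x}"
  have "(\<Sum>n \<in> {n \<in> {1..x}. \<not> prime n}. ?f n) = (\<Sum>n \<in> {n \<in> {1..x}. primepow n \<and> \<not> prime n}. ?f n)"
    by (intro sum.mono_neutral_right) (auto simp: mangoldt_def)
  also have "\<dots> \<le> (\<Sum>n \<in> (\<lambda>(q, k). q ^ k) ` ?A. ?f n)"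
  proof (intro sum_mono2)
    show "{n \<in> {1..x}. primepow n \<and> \<not> prime n} \<subseteq> (\<lambda>(q, k). q ^ k) ` ?A"
    proof safe
      fix n assume n: "n \<in> {1..x}" "primepow n" "\<not> prime n"
      then obtain q k where q: "prime q" "k > 0" "n = q ^ k" by (auto simp: primepow_def)
      have "k \<noteq> 1" using q n by auto
      \<comment> \<open>Exponents stay below the power itself, so \<open>{2..x}\<close> is a large
        enough range for \<open>k\<close>.\<close>
      moreover have "k < q ^ k" using power_gt_expt[of q k] prime_gt_1_nat[OF q(1)] by simp
      moreover have "q ^ 1 \<le> q ^ k" using q prime_gt_0_nat[OF q(1)] by (intro power_increasing) auto
      ultimately have "(q, k) \<in> ?A" using q n prime_ge_2_nat[OF q(1)] by auto
      then show "n \<in> (\<lambda>(q, k). q ^ k) ` ?A" using q by force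
    qed
  qed (auto simp: mangoldt_nonneg)
  also have "\<dots> \<le> (\<Sum>(q, k) \<in> ?A. ?f (q ^ k))"
    using sum_image_le[of ?A ?f "\<lambda>(q, k). q ^ k"] by (simp add: mangoldt_nonneg case_prod_unfold comp_def)
  also have "\<dots> = (\<Sum>q \<in> {q \<in> {2..x}. prime q}. \<Sum>k=2..x. ?f (q ^ k))"
    by (rule sum.cartesian_product[symmetric])
  also have "\<dots> \<le> (\<Sum>q \<in> {q \<in> {2..x}. prime q}. ln (real q) / (q * (q - 1)))"
  proof (intro sum_mono)
    fix q assume "q \<in> {q \<in> {2..x}. prime q}"
    then have q: "prime q" "q \<ge> 2" by auto
    have tele: "(\<Sum>k=2..Suc n. 1 / real q ^ k) \<le> (1 - 1 / real q ^ n) / (real q * (real q - 1))" for n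
    proof (induction n)
      case (Suc n)
      have *: "1 / (real q) ^ Suc (Suc n) = (1 / real q ^ n - 1 / real q ^ Suc n) / (real q * (real q - 1))"
        using q by (simp add: field_simps)
      have "(\<Sum>k=2..Suc (Suc n). 1 / real q ^ k) = (\<Sum>k=2..Suc n. 1 / real q ^ k) + 1 / (real q) ^ Suc (Suc n)"
        by simp
      also have "\<dots> \<le> (1 - 1 / real q ^ n) / (real q * (real q - 1)) + (1 / real q ^ n - 1 / real q ^ Suc n) / (real q * (real q - 1))"
        using Suc unfolding * by simp
      finally show ?case unfolding add_divide_distrib[symmetric] by simp
    qed auto
    have "(\<Sum>k=2..x. 1 / real q ^ k) \<le> 1 / (real q * (real q - 1))"
    proof (cases x)
      case (Suc n)
      have "(1 - 1 / real q ^ n) / (real q * (real q - 1)) \<le> 1 / (real q * (real q - 1))"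
        using q by (intro divide_right_mono) auto
      then show ?thesis using tele[of n] Suc by simp
    qed (use q in auto)
    then have "ln q * (\<Sum>k=2..x. 1 / real q ^ k) \<le> ln q * (1 / (real q * (real q - 1)))"
      using q by (intro mult_left_mono) auto
    also have "ln q * (\<Sum>k=2..x. 1 / real q ^ k) = (\<Sum>k=2..x. ?f (q ^ k))"
      unfolding sum_distrib_left using q by (intro sum.cong) auto
    also have "ln q * (1 / (real q * (real q - 1))) = ln (real q) / (q * (q - 1))"
      using q by (simp add: of_nat_diff)
    finally show "(\<Sum>k=2..x. ?f (q ^ k)) \<le> ln (real q) / (q * (q - 1))" .
  qed
  also have "\<dots> \<le> (\<Sum>q=2..x. ln (real q) / (q * (q - 1)))"
    by (intro sum_mono2) auto
  also have "\<dots> \<le> 2" by (rule sum_ln_over_square)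
  finally show ?thesis .
qed

section \<open>Characters with bounded partial sums\<close>

lemma norm_sum_abel_le:
  fixes a :: "nat \<Rightarrow> complex" and b :: "nat \<Rightarrow> real"
  assumes S: "\<And>x. norm (\<Sum>n=1..x. a n) \<le> B" and "m \<ge> 1"
    and dec: "\<And>n. m \<le> n \<Longrightarrow> b (Suc n) \<le> b n" and nonneg: "\<And>n. m \<le> n \<Longrightarrow> 0 \<le> b n"
  shows "norm (\<Sum>n=m..N. of_real (b n) * a n) \<le> 2 * B * b m"
proof (cases "m \<le> N")
  case True
  define S where "S = (\<lambda>x. \<Sum>n=1..x. a n)"
  have SB: "norm (S x) \<le> B" for x using assms(1) by (simp add: S_def)
  \<comment> \<open>Removing the boundary term of the summation by parts leaves increments (b N - b
    (N + 1)) S N, so the bound telescopes.\<close>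
  have "norm ((\<Sum>n=m..N. of_real (b n) * a n) - of_real (b N) * S N) \<le> B * (2 * b m - b N)"
    using True
  proof (induction N rule: dec_induct)
    case base
    obtain k where k: "m = Suc k" using \<open>m \<ge> 1\<close> by (cases m) auto
    have "of_real (b m) * a m - of_real (b m) * S m = - (of_real (b m) * S k)"
      by (simp add: S_def k algebra_simps)
    then have "norm (of_real (b m) * a m - of_real (b m) * S m) = b m * norm (S k)"
      using nonneg[of m] by (simp add: norm_mult)
    also have "\<dots> \<le> b m * B" using nonneg[of m] by (intro mult_left_mono SB) auto
    finally show ?case by (simp add: algebra_simps)
  next
    case (step N)
    have "(\<Sum>n=m..Suc N. of_real (b n) * a n) - of_real (b (Suc N)) * S (Suc N) =
       ((\<Sum>n=m..N. of_real (b n) * a n) - of_real (b N) * S N) + of_real (b N - b (Suc N)) * S N"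
      using step by (simp add: S_def algebra_simps)
    also have "norm \<dots> \<le> B * (2 * b m - b N) + (b N - b (Suc N)) * norm (S N)"
      using dec[of N] step by (intro norm_triangle_le add_mono) (auto simp: norm_mult simp flip: of_real_diff)
    also have "\<dots> \<le> B * (2 * b m - b N) + (b N - b (Suc N)) * B"
      using dec[of N] step by (intro add_left_mono mult_left_mono SB) auto
    finally show ?case by (simp add: algebra_simps)
  qed
  moreover have "norm (of_real (b N) * S N) \<le> b N * B"
    using nonneg[of N] True by (simp add: norm_mult mult_left_mono SB)
  ultimately have "norm (((\<Sum>n=m..N. of_real (b n) * a n) - of_real (b N) * S N) + of_real (b N) * S N)
      \<le> B * (2 * b m - b N) + b N * B"
    by (intro norm_triangle_le add_mono)
  then show ?thesis by (simp add: algebra_simps)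
next
  case False
  have "0 \<le> B" using S[of 0] by simp
  then show ?thesis using False nonneg[of m] by simp
qed

text \<open>The function ln t / t decreases only beyond e, hence the start at 3.\<close>

lemma ln_over_antimono:
  assumes "n \<ge> (3::nat)"
  shows "ln (real (Suc n)) / real (Suc n) \<le> ln (real n) / real n"
proof -
  have "exp 1 \<le> real n" using exp_le assms by simp
  then have 1: "1 \<le> ln (real n)" using assms by (subst ln_ge_iff) auto
  have "ln (real (Suc n)) - ln (real n) = ln (real (Suc n) / real n)"
    using assms by (subst ln_div) auto
  also have "real (Suc n) / real n = 1 + 1 / real n" using assms by (simp add: field_simps)
  also have "ln (1 + 1 / real n) \<le> 1 / real n" by (intro ln_add_one_self_le_self) auto
  finally have "n * (ln (real (Suc n)) - ln (real n)) \<le> n * (1 / real n)" 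
    by (intro mult_left_mono) auto
  also have "\<dots> \<le> ln (real n)" using 1 assms by simp
  finally show ?thesis using assms by (simp add: field_simps)
qed

definition partial_L_series :: "(nat \<Rightarrow> complex) \<Rightarrow> nat \<Rightarrow> complex" where
  "partial_L_series chi x = (\<Sum>n=1..x. chi n / of_nat n)"

text \<open>\<open>lim\<close> is unspecified for a divergent sequence;
  \<open>partial_L_tendsto\<close> supplies the convergence that gives the value its
  meaning.\<close>

definition L_value_one :: "(nat \<Rightarrow> complex) \<Rightarrow> complex" where
  "L_value_one chi = lim (partial_L_series chi)"

definition twisted_mangoldt_sum :: "(nat \<Rightarrow> complex) \<Rightarrow> nat \<Rightarrow> complex" where
  "twisted_mangoldt_sum chi x = (\<Sum>n=1..x. chi n * mangoldt n / of_nat n)"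

text \<open>What the analysis at 1 uses of a nonprincipal Dirichlet character; periodicity enters
  only through the bound \<open>B\<close>.\<close>

locale bounded_character =
  fixes chi :: "nat \<Rightarrow> complex" and B :: real
  assumes chi_mult: "chi (m * n) = chi m * chi n"
    and chi_one: "chi (Suc 0) = 1"
    and norm_chi: "norm (chi n) \<le> 1"
    and norm_sum_chi: "norm (\<Sum>n=1..x. chi n) \<le> B"
begin

abbreviation "partial_L \<equiv> partial_L_series chi"
abbreviation "L_one \<equiv> L_value_one chi"
abbreviation "mangoldt_sum_chi \<equiv> twisted_mangoldt_sum chi"

lemma B_nonneg: "0 \<le> B"
  using norm_sum_chi[of 0] by simp

lemma norm_partial_L_diff:
  assumes "M \<le> N"
  shows "norm (partial_L N - partial_L M) \<le> 2 * B / real (Suc M)"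
proof -
  have "partial_L N = partial_L M + (\<Sum>n=Suc M..N. chi n / of_nat n)"
    using sum.ub_add_nat[of 1 M "\<lambda>n. chi n / of_nat n" "N - M"] assms by (simp add: partial_L_series_def)
  then have "partial_L N - partial_L M = (\<Sum>n=Suc M..N. of_real (1 / real n) * chi n)"
    by (simp add: field_simps)
  also have "norm \<dots> \<le> 2 * B * (1 / real (Suc M))"
    by (intro norm_sum_abel_le norm_sum_chi) (auto simp: field_simps)
  finally show ?thesis by simp
qed

lemma partial_L_tendsto: "partial_L \<longlonglongrightarrow> L_one"
proof -
  have "Cauchy partial_L"
    unfolding Cauchy_altdef dist_norm
  proof (intro allI impI)
    fix e :: real assume "e > 0"
    obtain M where M: "real M > 2 * B / e" using reals_Archimedean2 by blast
    then have "2 * B / real (Suc m) < e" if "m \<ge> M" for m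
    proof -
      have "2 * B / e < real (Suc m)" using M that by linarith
      then show ?thesis using \<open>e > 0\<close> by (simp add: field_simps)
    qed
    then have "norm (partial_L m - partial_L n) < e" if "m \<ge> M" "n > m" for m n
      using norm_partial_L_diff[of m n] that by (subst norm_minus_commute) force
    then show "\<exists>M. \<forall>m\<ge>M. \<forall>n>m. norm (partial_L m - partial_L n) < e" by blast
  qed
  then show ?thesis unfolding L_value_one_def
    using Cauchy_convergent convergent_LIMSEQ_iff by blast
qed

lemma norm_L_one_diff: "norm (partial_L M - L_one) \<le> 2 * B / real (Suc M)"
proof -
  have "(\<lambda>N. norm (partial_L N - partial_L M)) \<longlonglongrightarrow> norm (L_one - partial_L M)"
    by (intro tendsto_intros partial_L_tendsto)
  moreover have "eventually (\<lambda>N. norm (partial_L N - partial_L M) \<le> 2 * B / real (Suc M)) sequentially"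
    using eventually_ge_at_top[of M] by eventually_elim (rule norm_partial_L_diff)
  ultimately have "norm (L_one - partial_L M) \<le> 2 * B / real (Suc M)"
    using tendsto_upperbound sequentially_bot by blast
  then show ?thesis by (simp add: norm_minus_commute)
qed

text \<open>\<open>Suc (x div d)\<close> exceeds x / d, so the tail of the series is O(d / x). The
  factor d cancels the 1 / d of the weights in the sums below.\<close>

lemma norm_L_one_diff_div:
  assumes "d \<in> {1..x}"
  shows "norm (partial_L (x div d) - L_one) \<le> 2 * B * (real d / real x)"
proof -
  have "x < (x div d + 1) * d" using assms dividend_less_div_times[of d x] by simp
  then have "real x < (real (x div d) + 1) * real d"
    by (metis of_nat_less_iff of_nat_mult of_nat_add of_nat_1)
  then have "1 / real (Suc (x div d)) \<le> real d / real x"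
    using assms by (simp add: field_simps)
  then have "2 * B * (1 / real (Suc (x div d))) \<le> 2 * B * (real d / real x)"
    using B_nonneg by (intro mult_left_mono) auto
  then show ?thesis using norm_L_one_diff[of "x div d"] by simp
qed

text \<open>The terms n = 1, 2 are bounded by 1 each; from 3 on the weight ln n / n is monotone and
  summation by parts applies.\<close>

lemma norm_sum_chi_ln:
  "norm (\<Sum>n=1..x. chi n * of_real (ln (real n)) / of_nat n) \<le> 2 + 2 * B * (ln 3 / 3)"
proof -
  let ?f = "\<lambda>n. chi n * of_real (ln (real n)) / of_nat n"
  have 0: "norm (?f n) \<le> 1" if "n \<ge> 1" for n
  proof -
    have "norm (?f n) = norm (chi n) * (ln (real n) / real n)"
      using that by (simp add: norm_mult norm_divide)
    also have "\<dots> \<le> 1 * 1" using that ln_bound[of "real n"]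
      by (intro mult_mono norm_chi) (auto simp: divide_le_eq)
    finally show ?thesis by simp
  qed
  have "norm (\<Sum>n=3..x. of_real (ln (real n) / real n) * chi n) \<le> 2 * B * (ln (real 3) / real 3)"
    by (intro norm_sum_abel_le norm_sum_chi ln_over_antimono) auto
  then have 1: "norm (\<Sum>n=3..x. ?f n) \<le> 2 * B * (ln 3 / 3)"
    by (simp add: mult.commute)
  have "norm (\<Sum>n \<in> {1..x} \<inter> {..2}. ?f n) \<le> of_nat (card ({1..x} \<inter> {..2})) * 1"
    using 0 by (intro order.trans[OF norm_sum] sum_bounded_above) auto
  also have "card ({1..x} \<inter> {..2}) \<le> card {1..2::nat}" by (intro card_mono) auto
  finally have 2: "norm (\<Sum>n \<in> {1..x} \<inter> {..2}. ?f n) \<le> 2" by simp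
  have "{1..x} = ({1..x} \<inter> {..2}) \<union> {3..x}" by auto
  then have "(\<Sum>n=1..x. ?f n) = (\<Sum>n \<in> {1..x} \<inter> {..2}. ?f n) + (\<Sum>n=3..x. ?f n)"
    by (metis (no_types, lifting) finite_Int finite_atLeastAtMost sum.union_disjoint
        disjoint_iff Int_iff atLeastAtMost_iff atMost_iff not_less_eq_eq numeral_3_eq_3 numeral_2_eq_2)
  then show ?thesis using norm_triangle_mono[OF 2 1] by simp
qed

text \<open>Expanding ln n into \<open>mangoldt\<close> turns the bounded sum of chi(n) ln n / n
  into a sum of chi(d) \<open>mangoldt d\<close> / d times \<open>partial_L (x div d)\<close>.
  Putting \<open>L_one\<close> in place of the partial sums costs at most 2 B / x times
  \<open>chebyshev_psi x\<close>, hence 12 B.\<close>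

lemma norm_L_one_mangoldt_sum:
  "norm (L_one * mangoldt_sum_chi x) \<le> 2 + 2 * B * (ln 3 / 3) + 12 * B"
proof (cases "x = 0")
  case False
  let ?c = "\<lambda>d. chi d * mangoldt d / of_nat d"
  have "(\<Sum>n=1..x. chi n * of_real (ln (real n)) / of_nat n) =
      (\<Sum>n=1..x. \<Sum>d | d dvd n. ?c d * (chi (n div d) / of_nat (n div d)))"
  proof (intro sum.cong refl)
    fix n assume n: "n \<in> {1..x}"
    have "chi n * of_real (ln (real n)) / of_nat n = (\<Sum>d | d dvd n. chi n * mangoldt d / of_nat n)"
      using n mangoldt_sum[of n, where 'a = complex] by (simp flip: sum_distrib_left sum_divide_distrib)
    also have "\<dots> = (\<Sum>d | d dvd n. ?c d * (chi (n div d) / of_nat (n div d)))"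
      using n by (intro sum.cong refl) (auto simp: chi_mult elim!: dvdE)
    finally show "chi n * of_real (ln (real n)) / of_nat n = \<dots>" .
  qed
  also have "\<dots> = (\<Sum>d=1..x. \<Sum>k=1..x div d. ?c d * (chi k / of_nat k))"
    by (rule sum_divisors_swap)
  also have "\<dots> = (\<Sum>d=1..x. ?c d * partial_L (x div d))"
    by (simp add: partial_L_series_def sum_distrib_left)
  also have "\<dots> = L_one * mangoldt_sum_chi x + (\<Sum>d=1..x. ?c d * (partial_L (x div d) - L_one))"
    unfolding twisted_mangoldt_sum_def sum_distrib_left sum.distrib[symmetric]
    by (intro sum.cong) (auto simp: algebra_simps diff_divide_distrib)
  finally have "L_one * mangoldt_sum_chi x = (\<Sum>n=1..x. chi n * of_real (ln (real n)) / of_nat n)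
      - (\<Sum>d=1..x. ?c d * (partial_L (x div d) - L_one))" by simp
  also have "norm \<dots> \<le> (2 + 2 * B * (ln 3 / 3)) + 12 * B"
  proof (intro norm_triangle_le_diff add_mono norm_sum_chi_ln)
    have "norm (\<Sum>d=1..x. ?c d * (partial_L (x div d) - L_one)) \<le> (\<Sum>d=1..x. 2 * B / x * mangoldt d)"
    proof (intro sum_norm_le)
      fix d assume d: "d \<in> {1..x}"
      have "norm (?c d * (partial_L (x div d) - L_one)) =
          norm (chi d) * ((mangoldt d / real d) * norm (partial_L (x div d) - L_one))"
        by (simp add: norm_mult norm_divide)
      also have "\<dots> \<le> 1 * ((mangoldt d / real d) * (2 * B * (real d / real x)))"
        using d by (intro mult_mono norm_chi norm_L_one_diff_div order.refl) (auto simp: mangoldt_nonneg)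
      also have "\<dots> = 2 * B / x * mangoldt d" using d by simp
      finally show "norm (?c d * (partial_L (x div d) - L_one)) \<le> 2 * B / x * mangoldt d" .
    qed
    also have "\<dots> = 2 * B / x * chebyshev_psi x" by (simp add: chebyshev_psi_def sum_distrib_left)
    also have "\<dots> \<le> 2 * B / x * (6 * real x)"
      using B_nonneg by (intro mult_left_mono chebyshev_psi_le) auto
    finally show "norm (\<Sum>d=1..x. ?c d * (partial_L (x div d) - L_one)) \<le> 12 * B"
      using False by simp
  qed
  finally show ?thesis .
qed (use B_nonneg in \<open>simp add: twisted_mangoldt_sum_def\<close>)

lemma mangoldt_sum_bounded:
  assumes "L_one \<noteq> 0"
  shows "\<exists>C. \<forall>x. norm (mangoldt_sum_chi x) \<le> C"
proof (intro exI allI)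
  fix x
  have "norm L_one * norm (mangoldt_sum_chi x) \<le> 2 + 2 * B * (ln 3 / 3) + 12 * B"
    using norm_L_one_mangoldt_sum[of x] by (simp add: norm_mult)
  then show "norm (mangoldt_sum_chi x) \<le> (2 + 2 * B * (ln 3 / 3) + 12 * B) / norm L_one"
    using assms by (simp add: field_simps)
qed

text \<open>The weights \<open>\<mu>(d) ln (x / d)\<close> turn a vanishing \<open>L(1, \<chi>)\<close> into the asymptotics \<open>- ln x\<close>.\<close>

lemma mangoldt_sum_if_L_one_zero:
  assumes "L_one = 0" "x \<ge> 1"
  shows "norm (mangoldt_sum_chi x + of_real (ln (real x))) \<le> 2 * B"
proof -
  let ?c = "\<lambda>d. chi d * of_real (moebius_mu d * ln (real x / real d)) / of_nat d"
  have "mangoldt_sum_chi x + of_real (ln (real x)) =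
      (\<Sum>n=1..x. chi n / of_nat n * of_real (mangoldt n + (if n = 1 then ln (real x) else 0)))"
  proof -
    have "(\<Sum>n=1..x. chi n / of_nat n * of_real (mangoldt n + (if n = 1 then ln (real x) else 0))) =
      mangoldt_sum_chi x + (\<Sum>n=1..x. if n = 1 then of_real (ln (real x)) else 0)"
      unfolding twisted_mangoldt_sum_def sum.distrib[symmetric]
      by (intro sum.cong) (auto simp: chi_one algebra_simps)
    then show ?thesis using assms by simp
  qed
  also have "\<dots> = (\<Sum>n=1..x. \<Sum>d | d dvd n. ?c d * (chi (n div d) / of_nat (n div d)))"
  proof (intro sum.cong refl)
    fix n assume n: "n \<in> {1..x}"
    \<comment> \<open>Split ln (x / d) = ln (n / d) + ln (x / n): the first part inverts to
      \<open>mangoldt n\<close>, the second survives only at n = 1.\<close>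
    have "mangoldt n + (if n = 1 then ln (real x) else 0) =
        (\<Sum>d | d dvd n. moebius_mu d * ln (real (n div d))) + (\<Sum>d | d dvd n. moebius_mu d) * ln (real x / real n)"
      using n by (auto simp: sum_moebius_mu sum_moebius_mu_ln)
    also have "\<dots> = (\<Sum>d | d dvd n. moebius_mu d * ln (real x / real d))"
      unfolding sum_distrib_right sum.distrib[symmetric]
    proof (intro sum.cong refl)
      fix d assume "d \<in> {d. d dvd n}"
      then obtain k where "n = d * k" by auto
      then show "moebius_mu d * ln (real (n div d)) + moebius_mu d * ln (real x / real n) =
          moebius_mu d * ln (real x / real d)"
        using n assms by (simp add: ln_div ln_mult algebra_simps)
    qed
    finally have "chi n / of_nat n * of_real (mangoldt n + (if n = 1 then ln (real x) else 0)) =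
       (\<Sum>d | d dvd n. chi n / of_nat n * of_real (moebius_mu d * ln (real x / real d)))"
      by (simp only: sum_distrib_left of_real_sum)
    also have "\<dots> = (\<Sum>d | d dvd n. ?c d * (chi (n div d) / of_nat (n div d)))"
      using n by (intro sum.cong refl) (auto simp: chi_mult elim!: dvdE)
    finally show "chi n / of_nat n * of_real (mangoldt n + (if n = 1 then ln (real x) else 0)) = \<dots>" .
  qed
  also have "\<dots> = (\<Sum>d=1..x. \<Sum>k=1..x div d. ?c d * (chi k / of_nat k))"
    by (rule sum_divisors_swap)
  also have "\<dots> = (\<Sum>d=1..x. ?c d * partial_L (x div d))"
    by (simp add: partial_L_series_def sum_distrib_left)
  \<comment> \<open>Since \<open>L_one = 0\<close>, the partial sums are themselves tails of size
    O(d / x). What remains is x ln x - ln x!, at most x by the Stirling bound.\<close>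
  also have "norm \<dots> \<le> (\<Sum>d=1..x. 2 * B / x * (ln (real x) - ln (real d)))"
  proof (intro sum_norm_le)
    fix d assume d: "d \<in> {1..x}"
    have *: "0 \<le> ln (real x / real d)" using d by simp
    have "norm (?c d * partial_L (x div d)) =
        (norm (chi d) * \<bar>moebius_mu d\<bar>) * ((ln (real x / real d) / real d) * norm (partial_L (x div d) - L_one))"
      using * assms by (simp add: norm_mult norm_divide abs_mult)
    also have "\<dots> \<le> (1 * 1) * ((ln (real x / real d) / real d) * (2 * B * (real d / real x)))"
      using d * by (intro mult_mono norm_chi norm_L_one_diff_div order.refl abs_moebius_mu_le) auto
    also have "\<dots> = 2 * B / x * (ln (real x) - ln (real d))" using d by (simp add: ln_div)
    finally show "norm (?c d * partial_L (x div d)) \<le> 2 * B / x * (ln (real x) - ln (real d))" .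
  qed
  also have "\<dots> = 2 * B / x * (x * ln (real x) - (\<Sum>d=1..x. ln (real d)))"
    unfolding sum_distrib_left[symmetric] sum_subtractf by simp
  also have "\<dots> \<le> 2 * B / x * real x"
    using B_nonneg sum_ln_lower[of x] by (intro mult_left_mono) auto
  finally show ?thesis using assms by simp
qed

end

section \<open>Nonvanishing of L(1) for real characters\<close>

context
  fixes s :: real assumes s: "0 < s" "s < 1"
begin

definition geom :: "nat \<Rightarrow> real" where "geom n = (\<Sum>i<n. (s\<^sup>2) ^ i)"

lemma geom_simps: "geom 0 = 0" "geom (Suc n) = 1 + s\<^sup>2 * geom n"
  by (simp_all add: geom_def sum.lessThan_Suc_shift sum_distrib_left del: sum.lessThan_Suc)

text \<open>AM-GM: the summands s^(2 i) with i \<le> n have geometric mean s^n. The two-step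
  induction peels off the outer pair, whose sum is at least 2 s^(n + 2).\<close>

lemma geom_ge: "geom (Suc n) \<ge> real (Suc n) * s ^ n"
proof (induction n rule: nat_induct2)
  case (step n)
  have "0 \<le> (1 - s ^ (n + 2))\<^sup>2" by simp
  then have "2 * s ^ (n + 2) \<le> 1 + s\<^sup>2 * (s ^ (n + 1))\<^sup>2"
    by (simp add: power2_eq_square algebra_simps)
  also have "(s ^ (n + 1))\<^sup>2 = (s\<^sup>2) ^ (n + 1)" by (simp only: power_mult[symmetric] mult.commute)
  finally have 1: "2 * s ^ (n + 2) \<le> 1 + s\<^sup>2 * (s\<^sup>2) ^ (n + 1)" .
  have "geom (Suc (Suc n)) = geom (Suc n) + (s\<^sup>2) ^ (n + 1)" by (simp add: geom_def)
  then have "geom (Suc (n + 2)) = (1 + s\<^sup>2 * (s\<^sup>2) ^ (n + 1)) + s\<^sup>2 * geom (Suc n)"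
    unfolding add_2_eq_Suc' geom_simps(2)[of "Suc (Suc n)"] by (simp add: algebra_simps)
  also have "\<dots> \<ge> 2 * s ^ (n + 2) + s\<^sup>2 * (real (Suc n) * s ^ n)"
    using step 1 by (intro add_mono mult_left_mono) auto
  finally show ?case by (simp add: algebra_simps power2_eq_square)
next
  case 1
  have "0 \<le> (1 - s)\<^sup>2" by simp
  then show ?case by (simp add: geom_def power2_eq_square algebra_simps)
qed (simp add: geom_def)

lemma one_minus_power: "1 - (s\<^sup>2) ^ n = (1 - s\<^sup>2) * geom n"
  by (simp add: geom_def one_diff_power_eq)

lemma s2: "0 < s\<^sup>2" "s\<^sup>2 < 1"
  using s by (auto simp: power_less_one_iff)

lemma geom_pos: "n > 0 \<Longrightarrow> geom n > 0"
  using s2 by (auto simp: geom_def intro!: sum_pos)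

text \<open>With \<open>t = s\<^sup>2\<close>, this is the difference of the coefficients of \<open>\<chi>(n)\<close> in the two series
  of Monsky's argument below. Writing \<open>t\<close> as a square keeps square roots out of the AM-GM step.\<close>

definition monsky :: "nat \<Rightarrow> real" where
  "monsky n = 1 / (real n * (1 - s\<^sup>2)) - (s\<^sup>2) ^ n / (1 - (s\<^sup>2) ^ n)"

lemma monsky_eq:
  assumes "n > 0"
  shows "monsky n = (1 / real n - (s\<^sup>2) ^ n / geom n) / (1 - s\<^sup>2)"
  unfolding monsky_def one_minus_power by (simp add: diff_divide_distrib mult.commute)

lemma monsky_nonneg: "monsky n \<ge> 0" if "n \<ge> 1"
proof -
  have "of_nat (card {..<n}) * (s\<^sup>2) ^ n \<le> geom n"
    unfolding geom_def using s2 by (intro sum_bounded_below power_decreasing) auto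
  then have "(s\<^sup>2) ^ n / geom n \<le> 1 / real n"
    using geom_pos[of n] that by (simp add: field_simps)
  then show ?thesis using that s2 by (simp add: monsky_eq)
qed

text \<open>With t = s^2 and 1 - t cleared, consecutive differences reduce the claim to t^n / (geom
  n geom (n + 1)) \<le> 1 / (n (n + 1)). AM-GM for both factors gives this with s^(2 n - 1) in place
  of the smaller t^n = s^(2 n).\<close>

lemma monsky_antimono: "monsky (Suc n) \<le> monsky n" if n: "n \<ge> 1"
proof -
  let ?t = "s\<^sup>2"
  obtain m where m: "n = Suc m" using n by (cases n) auto
  have pos: "geom n > 0" "geom (Suc n) > 0" using that geom_pos by auto
  have "?t ^ n = s ^ (2 * n)" by (simp add: power_mult)
  also have "\<dots> \<le> s ^ (m + n)" using s m by (intro power_decreasing) auto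
  finally have "real n * real (Suc n) * ?t ^ n \<le> real n * real (Suc n) * (s ^ m * s ^ n)"
    unfolding power_add by (intro mult_left_mono) auto
  also have "\<dots> = (real n * s ^ m) * (real (Suc n) * s ^ n)" by simp
  also have "\<dots> \<le> geom n * geom (Suc n)"
    using s geom_ge[of m] geom_ge[of n] m pos by (intro mult_mono) auto
  finally have *: "?t ^ n / (geom n * geom (Suc n)) \<le> 1 / (real n * real (Suc n))"
    using pos that by (simp add: divide_simps mult_ac del: of_nat_Suc)
  have "?t ^ n / geom n - ?t ^ Suc n / geom (Suc n) = ?t ^ n * (geom (Suc n) - ?t * geom n) / (geom n * geom (Suc n))"
    using pos by (simp add: field_simps)
  also have "geom (Suc n) - ?t * geom n = 1" by (simp add: geom_simps)
  finally have "?t ^ n / geom n - ?t ^ Suc n / geom (Suc n) \<le> 1 / (real n * real (Suc n))" using * by simp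
  also have "\<dots> = 1 / real n - 1 / real (Suc n)" using that by (simp add: field_simps)
  finally show ?thesis using that s2 by (simp add: monsky_eq divide_right_mono)
qed

text \<open>Independence of \<open>s\<close> makes the summation by parts uniform as
  \<open>s\<close> tends to 1.\<close>

lemma monsky_1: "monsky 1 = 1"
  using s2 by (simp add: monsky_def field_simps)

text \<open>The first omitted exponent \<open>n * Suc (N div n)\<close> is at least
  \<open>N\<close>, and 1 - t^n \<ge> 1 - t for t = s^2.\<close>

lemma lambert_term:
  assumes "n \<ge> 1"
  shows "\<bar>(s\<^sup>2) ^ n / (1 - (s\<^sup>2) ^ n) - (\<Sum>k=1..N div n. (s\<^sup>2) ^ (n * k))\<bar> \<le> (s\<^sup>2) ^ N / (1 - s\<^sup>2)"
proof -
  define u where "u = (s\<^sup>2) ^ n"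
  define y where "y = N div n"
  have u: "0 < u" "u < 1" "u \<le> s\<^sup>2" using s2 assms power_decreasing[of 1 n "s\<^sup>2"]
    by (auto simp: u_def power_less_one_iff)
  have "(\<Sum>k=1..m. u ^ k) = u / (1 - u) - u ^ Suc m / (1 - u)" for m
  proof (induction m)
    case (Suc m)
    have "u ^ Suc m = u ^ Suc m / (1 - u) - u ^ Suc (Suc m) / (1 - u)"
      unfolding diff_divide_distrib[symmetric] using u by (simp add: nonzero_eq_divide_eq algebra_simps)
    then show ?case using Suc by simp
  qed auto
  from this[of y] have "u / (1 - u) - (\<Sum>k=1..y. u ^ k) = u ^ Suc y / (1 - u)" by simp
  moreover have "(\<Sum>k=1..y. u ^ k) = (\<Sum>k=1..y. (s\<^sup>2) ^ (n * k))" by (simp add: u_def power_mult)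
  moreover have "u ^ Suc y / (1 - u) \<le> (s\<^sup>2) ^ N / (1 - s\<^sup>2)"
  proof (rule frac_le)
    have "N < (y + 1) * n" using assms dividend_less_div_times[of n N] by (simp add: y_def)
    then have "N \<le> n * Suc y" by (simp add: mult.commute)
    then have "(s\<^sup>2) ^ (n * Suc y) \<le> (s\<^sup>2) ^ N" using s2 by (intro power_decreasing) auto
    then show "u ^ Suc y \<le> (s\<^sup>2) ^ N" by (simp only: u_def power_mult)
  qed (use u s2 in auto)
  moreover have "0 \<le> u ^ Suc y / (1 - u)" using u by simp
  ultimately show ?thesis unfolding u_def[symmetric] y_def[symmetric] by linarith
qed

end

text \<open>Local factor at a prime power of the divisor sum of a real character; even exponents are
  those of squares.\<close>

lemma sum_powers_nonneg:
  fixes r :: real assumes "r \<in> {- 1, 0, 1}"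
  shows "(\<Sum>i\<le>k. r ^ i) \<ge> (if even k then 1 else 0)"
proof -
  have "(\<Sum>i\<le>k. 0 ^ i) = (1::real)" by (induction k) auto
  moreover have "(\<Sum>i\<le>k. (- 1) ^ i) = (if even k then 1 else 0 :: real)" by (induction k) auto
  ultimately show ?thesis using assms by auto
qed

context bounded_character
begin

text \<open>Monsky's argument: the Lambert series \<open>\<Sum> \<chi>(n) t\<^sup>n / (1 - t\<^sup>n)\<close> has nonnegative coefficients that are
  at least 1 at squares, hence is unbounded as \<open>t \<rightarrow> 1\<close>. Comparing it with
  \<open>\<Sum> \<chi>(n) / (n (1 - t)) = L(1, \<chi>) / (1 - t)\<close> by summation by parts shows that it would be bounded
  if \<open>L(1, \<chi>) = 0\<close>.\<close>

lemma L_one_real_nonzero: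
  assumes real: "\<And>n. chi n \<in> {- 1, 0, 1}"
  shows "L_one \<noteq> 0"
proof
  assume L0: "L_one = 0"
  define r where "r = (\<lambda>n. Re (chi n))"
  have chi_r: "chi n = of_real (r n)" and r: "r n \<in> {- 1, 0, 1}" for n
    using real[of n] by (auto simp: r_def)
  have r_mult: "r (m * n) = r m * r n" for m n
    using chi_mult[of m n] unfolding chi_r by (simp flip: of_real_mult)
  have r_1: "r (Suc 0) = 1" using chi_one by (simp add: r_def)
  have r_power: "r (m ^ k) = r m ^ k" for m k by (induction k) (auto simp: r_mult r_1)
  have abs_r: "\<bar>r n\<bar> \<le> 1" for n using r[of n] by auto
  define c where "c = (\<lambda>n. \<Sum>d | d dvd n. r d)"
  have c_step: "c (p ^ k * m) = (\<Sum>i\<le>k. r p ^ i) * c m" if "prime p" "m > 0" "coprime p m" for p k m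
    unfolding c_def using that prime_gt_0_nat[OF that(1)]
    by (subst sum_divisors_mult_coprime[where g = r and h = r])
       (auto simp: r_mult sum_divisors_prime_power r_power)
  have c_nonneg: "c n \<ge> 0" if "n > 0" for n
    using that
  proof (induction n rule: prime_power_coprime_induct)
    case one then show ?case by (simp add: c_def r_1)
  next
    case (step p k m)
    have "(\<Sum>i\<le>k. r p ^ i) \<ge> 0" using sum_powers_nonneg[OF r[of p], of k] by (auto split: if_splits)
    then show ?case using step by (simp add: c_step)
  qed
  have c_square: "c (n\<^sup>2) \<ge> 1" if "n > 0" for n
    using that
  proof (induction n rule: prime_power_coprime_induct)
    case one then show ?case by (simp add: c_def r_1)
  next
    case (step p k m)
    have "(\<Sum>i\<le>2 * k. r p ^ i) \<ge> 1" using sum_powers_nonneg[OF r[of p], of "2 * k"] by simp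
    moreover have "(p ^ k * m)\<^sup>2 = p ^ (2 * k) * m\<^sup>2"
      by (simp add: power_mult_distrib power_mult[symmetric] mult.commute)
    ultimately show ?case using step mult_mono[of 1 "\<Sum>i\<le>2 * k. r p ^ i" 1 "c (m\<^sup>2)"]
      by (simp add: c_step)
  qed
  \<comment> \<open>The right-hand side is free of \<open>s\<close> and \<open>K\<close>, so letting
    \<open>s\<close> tend to 1 forces K \<le> 2 B for every \<open>K\<close>.\<close>
  have bound_s: "real K * (s\<^sup>2) ^ (K\<^sup>2) \<le> 2 * B" if s: "0 < s" "s < 1" for s K
  proof -
    define t where "t = s\<^sup>2"
    have t: "0 < t" "t < 1" using s2[OF s] by (auto simp: t_def)
    \<comment> \<open>All series are cut at \<open>N\<close>. The last two error terms vanish as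
      \<open>N\<close> grows, the first of them because \<open>L_one = 0\<close>.\<close>
    have fin: "real K * t ^ (K\<^sup>2) \<le> 2 * B + norm (partial_L N) / (1 - t) + real N * t ^ N / (1 - t)"
      if N: "N \<ge> K\<^sup>2" for N
    proof -
      have "real K * t ^ (K\<^sup>2) = of_nat (card {1..K}) * t ^ (K\<^sup>2)" by simp
      also have "\<dots> \<le> (\<Sum>k=1..K. t ^ (k\<^sup>2))"
        using t by (intro sum_bounded_below power_decreasing) auto
      also have "\<dots> \<le> (\<Sum>k=1..K. c (k\<^sup>2) * t ^ (k\<^sup>2))"
      proof (intro sum_mono)
        fix k assume "k \<in> {1..K}"
        then have "1 * t ^ (k\<^sup>2) \<le> c (k\<^sup>2) * t ^ (k\<^sup>2)" using c_square[of k] t by (intro mult_right_mono) auto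
        then show "t ^ (k\<^sup>2) \<le> c (k\<^sup>2) * t ^ (k\<^sup>2)" by simp
      qed
      also have "\<dots> = (\<Sum>m\<in>(\<lambda>k. k\<^sup>2) ` {1..K}. c m * t ^ m)"
        by (subst sum.reindex) (auto simp: inj_on_def)
      also have "\<dots> \<le> (\<Sum>m=1..N. c m * t ^ m)"
      proof (intro sum_mono2)
        show "(\<lambda>k. k\<^sup>2) ` {1..K} \<subseteq> {1..N}"
        proof safe
          fix k assume k: "k \<in> {1..K}"
          then have "k\<^sup>2 \<le> K\<^sup>2" by (intro power_mono) auto
          then show "k\<^sup>2 \<in> {1..N}" using le_trans[OF _ N] k by (simp add: Suc_le_eq)
        qed
      qed (use t c_nonneg in auto)
      also have "\<dots> = (\<Sum>m=1..N. \<Sum>d | d dvd m. r d * t ^ (d * (m div d)))"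
        unfolding c_def sum_distrib_right by (intro sum.cong refl) auto
      also have "\<dots> = (\<Sum>n=1..N. \<Sum>k=1..N div n. r n * t ^ (n * k))" by (rule sum_divisors_swap)
      also have "\<dots> = (\<Sum>n=1..N. r n * (\<Sum>k=1..N div n. t ^ (n * k)))" by (simp add: sum_distrib_left)
      also have "\<dots> \<le> (\<Sum>n=1..N. r n * (t ^ n / (1 - t ^ n)) + t ^ N / (1 - t))"
      proof (intro sum_mono)
        fix n assume n: "n \<in> {1..N}"
        define x where "x = t ^ n / (1 - t ^ n)"
        define y where "y = (\<Sum>k=1..N div n. t ^ (n * k))"
        have "\<bar>x - y\<bar> \<le> t ^ N / (1 - t)"
          using lambert_term[OF s, of n N] n by (simp add: t_def x_def y_def)
        moreover have "\<bar>r n * (y - x)\<bar> \<le> 1 * \<bar>x - y\<bar>"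
          unfolding abs_mult using abs_r[of n] by (intro mult_mono) auto
        ultimately have "r n * (y - x) \<le> t ^ N / (1 - t)" by (metis abs_le_D1 mult_1 order_trans)
        then show "r n * y \<le> r n * x + t ^ N / (1 - t)" by (simp add: algebra_simps)
      qed
      also have "\<dots> = (\<Sum>n=1..N. r n * (t ^ n / (1 - t ^ n))) + real N * t ^ N / (1 - t)"
        by (simp add: sum.distrib)
      also have "(\<Sum>n=1..N. r n * (t ^ n / (1 - t ^ n))) \<le> 2 * B + norm (partial_L N) / (1 - t)"
      proof -
        \<comment> \<open>Comparison with the terms chi(n) / (n (1 - t)) leaves the monotone weights
          \<open>monsky s n\<close>, to which summation by parts applies.\<close>
        have "of_real (\<Sum>n=1..N. r n * (t ^ n / (1 - t ^ n))) =
            partial_L N / of_real (1 - t) - (\<Sum>n=1..N. of_real (monsky s n) * chi n)"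
          unfolding partial_L_series_def of_real_sum sum_divide_distrib sum_subtractf[symmetric]
        proof (intro sum.cong refl)
          fix n assume "n \<in> {1..N}"
          have "r n * (t ^ n / (1 - t ^ n)) = r n / real n / (1 - t) - monsky s n * r n"
            using s2[OF s] by (simp add: monsky_def[OF s] t_def algebra_simps)
          then show "of_real (r n * (t ^ n / (1 - t ^ n))) = 
              chi n / of_nat n / of_real (1 - t) - of_real (monsky s n) * chi n"
            unfolding chi_r by (simp only: of_real_diff of_real_mult of_real_divide of_real_of_nat_eq)
        qed
        moreover have "norm (\<Sum>n=1..N. of_real (monsky s n) * chi n) \<le> 2 * B * monsky s 1"
          using monsky_antimono[OF s] monsky_nonneg[OF s]
          by (intro norm_sum_abel_le norm_sum_chi) auto
        ultimately have "norm (complex_of_real (\<Sum>n=1..N. r n * (t ^ n / (1 - t ^ n))))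
            \<le> norm (partial_L N / of_real (1 - t)) + 2 * B"
          unfolding monsky_1[OF s] by (simp only: norm_triangle_le_diff add_left_mono mult_1_right)
        moreover have "norm (partial_L N / of_real (1 - t)) = norm (partial_L N) / (1 - t)"
          unfolding norm_divide norm_of_real using t by simp
        ultimately show ?thesis unfolding norm_of_real by linarith
      qed
      finally show ?thesis by simp
    qed
    have "(\<lambda>N. 2 * B + norm (partial_L N) / (1 - t) + real N * t ^ N / (1 - t)) \<longlonglongrightarrow> 2 * B + norm (0::complex) / (1 - t) + 0 / (1 - t)"
      using partial_L_tendsto t powser_times_n_limit_0[of t] unfolding L0 by (intro tendsto_intros) auto
    moreover have "eventually (\<lambda>N. real K * t ^ (K\<^sup>2) \<le> 2 * B + norm (partial_L N) / (1 - t) + real N * t ^ N / (1 - t)) sequentially"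
      using eventually_ge_at_top[of "K\<^sup>2"] by eventually_elim (rule fin)
    ultimately have "real K * t ^ (K\<^sup>2) \<le> 2 * B + norm (0::complex) / (1 - t) + 0 / (1 - t)"
      by (rule tendsto_lowerbound) simp
    then show ?thesis by (simp add: t_def)
  qed
  obtain K :: nat where K: "real K > 2 * B" using reals_Archimedean2 by blast
  have "((\<lambda>s. real K * (s\<^sup>2) ^ (K\<^sup>2)) \<longlongrightarrow> real K * (1\<^sup>2) ^ (K\<^sup>2)) (at_left 1)"
    by (intro tendsto_intros)
  moreover have "eventually (\<lambda>s. real K * (s\<^sup>2) ^ (K\<^sup>2) \<le> 2 * B) (at_left 1)"
    unfolding eventually_at_left_field using bound_s by (intro exI[of _ 0]) auto
  ultimately have "real K * (1\<^sup>2) ^ (K\<^sup>2) \<le> 2 * B"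
    by (rule tendsto_upperbound) auto
  then show False using K by simp
qed

end

section \<open>Primes in residue classes modulo a prime\<close>

locale prime_primroot =
  fixes p g :: nat
  assumes p: "prime p" and g: "residue_primroot p g"
begin

lemma p_gt_1: "p > 1" and coprime_p_g: "coprime p g" and ord_p_g: "ord p g = p - 1"
  using p g prime_gt_1_nat by (auto simp: residue_primroot_def totient_prime)

text \<open>Discrete logarithm to base \<open>g\<close>, unspecified on multiples of
  \<open>p\<close>, where \<open>chi\<close> is set to 0.\<close>

definition ind :: "nat \<Rightarrow> nat" where
  "ind n = (SOME k. k < p - 1 \<and> [g ^ k = n] (mod p))"

lemma bij_betw_primroot_powers: "bij_betw (\<lambda>k. g ^ k mod p) {..<p - 1} {0<..<p}"
  using residue_primroot_is_generator[OF p_gt_1 g] p by (simp add: totatives_prime totient_prime)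

lemma ind:
  assumes "\<not> p dvd n"
  shows "ind n < p - 1" "[g ^ ind n = n] (mod p)"
proof -
  have "n mod p \<in> {0<..<p}" using assms p_gt_1 by (auto simp: dvd_eq_mod_eq_0)
  then obtain k where "k < p - 1" "n mod p = g ^ k mod p"
    unfolding bij_betw_imp_surj_on[OF bij_betw_primroot_powers, symmetric] by auto
  then have "\<exists>k. k < p - 1 \<and> [g ^ k = n] (mod p)" by (auto simp: cong_def)
  from someI_ex[OF this] show "ind n < p - 1" "[g ^ ind n = n] (mod p)" by (auto simp: ind_def)
qed

definition unity_root :: "nat \<Rightarrow> complex" where
  "unity_root j = cis (2 * pi * real j / real (p - 1))"

text \<open>The characters mod \<open>p\<close>, indexed by \<open>j < p - 1\<close> through their
  value at \<open>g\<close>; \<open>j = 0\<close> is the principal one.\<close>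

definition chi :: "nat \<Rightarrow> nat \<Rightarrow> complex" where
  "chi j n = (if p dvd n then 0 else unity_root j ^ ind n)"

lemma unity_root_power: "unity_root j ^ k = unity_root (j * k)"
  by (simp add: unity_root_def DeMoivre mult_ac)

lemma bij_betw_unity_root: "bij_betw unity_root {..<p - 1} {z. z ^ (p - 1) = 1}"
  using bij_betw_roots_unity[of "p - 1"] p_gt_1 by (simp add: unity_root_def[abs_def])

lemma unity_root_0: "unity_root 0 = 1"
  by (simp add: unity_root_def)

lemma unity_root_period: "unity_root (j + (p - 1)) = unity_root j"
proof -
  have "2 * pi * real (j + (p - 1)) / real (p - 1) = 2 * pi * real j / real (p - 1) + 2 * pi"
    using p_gt_1 by (simp add: field_simps)
  then show ?thesis by (simp add: unity_root_def cis.ctr)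
qed

lemma unity_root_power_p: "unity_root j ^ (p - 1) = 1"
proof -
  have "unity_root (j * (p - 1)) = 1"
  proof (induction j)
    case (Suc j)
    have "Suc j * (p - 1) = j * (p - 1) + (p - 1)" by simp
    then show ?case using Suc unity_root_period by metis
  qed (simp add: unity_root_0)
  then show ?thesis by (simp add: unity_root_power)
qed

lemma unity_root_eq_1_iff: "j < p - 1 \<Longrightarrow> unity_root j = 1 \<longleftrightarrow> j = 0"
  using inj_onD[OF bij_betw_imp_inj_on[OF bij_betw_unity_root], of j 0] unity_root_0 by auto

lemma unity_root_power_cong:
  assumes "[k = l] (mod p - 1)"
  shows "unity_root j ^ k = unity_root j ^ l"
proof -
  have "unity_root j ^ k = unity_root j ^ (k mod (p - 1))" for k
  proof -
    have "unity_root j ^ k = unity_root j ^ ((p - 1) * (k div (p - 1)) + k mod (p - 1))" by simp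
    also have "\<dots> = unity_root j ^ (k mod (p - 1))" by (simp only: power_add power_mult unity_root_power_p) simp
    finally show ?thesis .
  qed
  then show ?thesis using assms by (metis cong_def)
qed

text \<open>Exponents of \<open>g\<close> matter only mod \<open>p - 1\<close>, so any one
  representing \<open>n\<close> may replace \<open>ind n\<close>. Periodicity and multiplicativity
  follow.\<close>

lemma chi_eqI:
  assumes "[g ^ k = n] (mod p)"
  shows "chi j n = unity_root j ^ k"
proof -
  have "coprime p n" using assms coprime_p_g
    by (metis cong_imp_coprime coprime_commute coprime_power_right_iff)
  then have n: "\<not> p dvd n" using coprime_common_divisor[of p n p] p_gt_1 by auto
  have "[g ^ ind n = g ^ k] (mod p)" using ind(2)[OF n] assms cong_sym cong_trans by blast
  then have "[ind n = k] (mod p - 1)"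
    using order_divides_expdiff[OF coprime_p_g] by (simp add: ord_p_g)
  then show ?thesis using n by (simp add: chi_def unity_root_power_cong)
qed

lemma chi_cong:
  assumes "[m = n] (mod p)"
  shows "chi j m = chi j n"
proof (cases "p dvd n")
  case True
  then show ?thesis using assms cong_dvd_iff by (auto simp: chi_def)
next
  case False
  then show ?thesis using ind(2)[OF False] assms
    by (metis chi_eqI cong_sym cong_trans)
qed

lemma chi_mult: "chi j (m * n) = chi j m * chi j n"
proof (cases "p dvd m \<or> p dvd n")
  case True
  then show ?thesis using p by (auto simp: chi_def)
next
  case False
  then have mn: "\<not> p dvd m" "\<not> p dvd n" by auto
  have "[g ^ (ind m + ind n) = m * n] (mod p)"
    unfolding power_add by (intro cong_mult ind mn)
  from chi_eqI[OF this] show ?thesis using mn by (simp add: chi_def power_add)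
qed

lemma chi_one: "chi j (Suc 0) = 1"
  using chi_eqI[of 0 1] by simp

lemma norm_chi: "norm (chi j n) \<le> 1"
  by (simp add: chi_def unity_root_def norm_power)

lemma chi_0: "chi 0 n = (if p dvd n then 0 else 1)"
  by (simp add: chi_def unity_root_0)

text \<open>Running through the residues as powers of \<open>g\<close> turns the sum into a full
  geometric sum of a nontrivial root of unity.\<close>

lemma sum_chi_period:
  assumes "0 < j" "j < p - 1"
  shows "(\<Sum>n=1..p. chi j n) = 0"
proof -
  have "(\<Sum>n=1..p. chi j n) = (\<Sum>n\<in>{0<..<p}. chi j n)"
    by (intro sum.mono_neutral_right) (auto simp: chi_def)
  also have "\<dots> = (\<Sum>k<p - 1. chi j (g ^ k mod p))"
    by (rule sum.reindex_bij_betw[OF bij_betw_primroot_powers, symmetric])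
  also have "\<dots> = (\<Sum>k<p - 1. unity_root j ^ k)"
    by (intro sum.cong chi_eqI) (auto simp: cong_def)
  also have "\<dots> = 0"
    using assms unity_root_eq_1_iff[of j] unity_root_power_p[of j] by (simp add: geometric_sum)
  finally show ?thesis .
qed

lemma norm_sum_chi:
  assumes "0 < j" "j < p - 1"
  shows "norm (\<Sum>n=1..x. chi j n) \<le> real p"
proof -
  have period: "(\<Sum>n=1..x + p. chi j n) = (\<Sum>n=1..x. chi j n)" for x
  proof (induction x)
    case (Suc x)
    have "chi j (Suc x + p) = chi j (Suc x)" by (rule chi_cong) (metis cong_def mod_add_self2)
    then show ?case using Suc by simp
  qed (use sum_chi_period[OF assms] in simp)
  have "(\<Sum>n=1..x mod p + k * p. chi j n) = (\<Sum>n=1..x mod p. chi j n)" for k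
  proof (induction k)
    case (Suc k)
    have "x mod p + Suc k * p = (x mod p + k * p) + p" by simp
    then show ?case using Suc period by metis
  qed simp
  from this[of "x div p"] have "(\<Sum>n=1..x. chi j n) = (\<Sum>n=1..x mod p. chi j n)" by simp
  also have "norm \<dots> \<le> of_nat (card {1..x mod p}) * 1"
    by (intro order.trans[OF norm_sum] sum_bounded_above norm_chi)
  also have "\<dots> \<le> real p" using p_gt_1 by (simp add: less_imp_le)
  finally show ?thesis .
qed

lemma bounded_character_chi:
  assumes "0 < j" "j < p - 1"
  shows "bounded_character (chi j) (real p)"
  using norm_sum_chi[OF assms] by unfold_locales (auto simp: chi_mult chi_one norm_chi)

text \<open>Orthogonality: as a function of \<open>j\<close> the summand is a power of one root of
  unity, which equals 1 exactly when \<open>ind n = 0\<close>.\<close>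

lemma sum_chi:
  "(\<Sum>j<p - 1. chi j n) = (if [n = 1] (mod p) then of_nat (p - 1) else 0)"
proof (cases "p dvd n")
  case True
  then have "\<not> [n = 1] (mod p)" using p_gt_1 cong_dvd_iff[of n 1 p] by auto
  then show ?thesis using True by (simp add: chi_def)
next
  case False
  define z where "z = unity_root (ind n)"
  have "(\<Sum>j<p - 1. chi j n) = (\<Sum>j<p - 1. z ^ j)"
    using False by (intro sum.cong) (auto simp: chi_def z_def unity_root_power mult.commute)
  moreover have "z = 1 \<longleftrightarrow> [n = 1] (mod p)"
  proof
    assume "z = 1"
    then have "ind n = 0" using ind(1)[OF False] unity_root_eq_1_iff by (simp add: z_def)
    then show "[n = 1] (mod p)" using ind(2)[OF False] cong_sym by fastforce
  next
    assume "[n = 1] (mod p)"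
    then have "chi 1 n = 1" using chi_cong chi_one by fastforce
    then show "z = 1" using False by (simp add: chi_def unity_root_power z_def)
  qed
  moreover have "z ^ (p - 1) = 1" unfolding z_def by (rule unity_root_power_p)
  ultimately show ?thesis by (cases "z = 1") (auto simp: geometric_sum)
qed

text \<open>The inverse \<open>a'\<close> plays the part of the conjugate character value, so
  orthogonality at \<open>a' * n\<close> selects the class of \<open>a\<close>.\<close>

lemma sum_chi_twisted_mangoldt_sum:
  assumes "[a * a' = 1] (mod p)"
  shows "(\<Sum>j<p - 1. chi j a' * twisted_mangoldt_sum (chi j) x) =
     of_real (real (p - 1) * (\<Sum>n | n \<in> {1..x} \<and> [n = a] (mod p). mangoldt n / real n))"
proof -
  have iff: "[a' * n = 1] (mod p) \<longleftrightarrow> [n = a] (mod p)" for n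
  proof
    assume "[a' * n = 1] (mod p)"
    then have "[a * (a' * n) = a * 1] (mod p)" by (intro cong_mult) auto
    moreover have "[(a * a') * n = 1 * n] (mod p)" using assms by (intro cong_mult) auto
    ultimately show "[n = a] (mod p)" by (simp add: mult.assoc) (meson cong_sym cong_trans)
  next
    assume "[n = a] (mod p)"
    then have "[a' * n = a' * a] (mod p)" by (intro cong_mult) auto
    then show "[a' * n = 1] (mod p)" using assms by (metis cong_trans mult.commute)
  qed
  have "(\<Sum>j<p - 1. chi j a' * twisted_mangoldt_sum (chi j) x) =
      (\<Sum>j<p - 1. \<Sum>n=1..x. chi j (a' * n) * (mangoldt n / of_nat n))"
    by (simp add: twisted_mangoldt_sum_def sum_distrib_left chi_mult mult_ac)
  also have "\<dots> = (\<Sum>n=1..x. (\<Sum>j<p - 1. chi j (a' * n)) * (mangoldt n / of_nat n))"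
    unfolding sum_distrib_right by (rule sum.swap)
  also have "\<dots> = (\<Sum>n=1..x. if [n = a] (mod p) then of_nat (p - 1) * (mangoldt n / of_nat n) else 0)"
    unfolding sum_chi iff by (intro sum.cong) auto
  also have "\<dots> = (\<Sum>n | n \<in> {1..x} \<and> [n = a] (mod p). of_nat (p - 1) * (mangoldt n / of_nat n))"
    by (simp only: sum.inter_filter[symmetric] finite_atLeastAtMost)
  also have "\<dots> = of_real (real (p - 1) * (\<Sum>n | n \<in> {1..x} \<and> [n = a] (mod p). mangoldt n / real n))"
    by (simp only: of_real_mult of_real_sum of_real_divide of_real_mangoldt of_real_of_nat_eq sum_distrib_left)
  finally show ?thesis .
qed

section \<open>Mertens' estimate in a residue class\<close>

definition principal_sum :: "nat \<Rightarrow> real" where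
  "principal_sum x = (\<Sum>n | n \<in> {1..x} \<and> \<not> p dvd n. mangoldt n / real n)"

lemma twisted_mangoldt_sum_chi_0: "twisted_mangoldt_sum (chi 0) x = of_real (principal_sum x)"
proof -
  have "twisted_mangoldt_sum (chi 0) x = (\<Sum>n=1..x. if \<not> p dvd n then mangoldt n / of_nat n else 0)"
    unfolding twisted_mangoldt_sum_def chi_0 by (intro sum.cong) auto
  also have "\<dots> = (\<Sum>n | n \<in> {1..x} \<and> \<not> p dvd n. mangoldt n / of_nat n)"
    by (simp only: sum.inter_filter[symmetric] finite_atLeastAtMost)
  finally show ?thesis unfolding principal_sum_def
    by (simp only: of_real_sum of_real_divide of_real_mangoldt of_real_of_nat_eq)
qed

lemma principal_sum_le: "principal_sum x \<le> ln (real x) + 6" if "x \<ge> 1"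
proof -
  have "principal_sum x \<le> (\<Sum>n=1..x. mangoldt n / real n)"
    unfolding principal_sum_def by (intro sum_mono2) (auto simp: mangoldt_nonneg)
  then show ?thesis using sum_mangoldt_over[OF that] by linarith
qed

text \<open>The discarded multiples of \<open>p\<close> are \<open>p\<close> itself and nonprimes: 8
  is 6 from Mertens plus 2 from the nonprimes.\<close>

lemma principal_sum_ge: "principal_sum x \<ge> ln (real x) - 8 - ln (real p) / real p" if "x \<ge> 1"
proof -
  have "(\<Sum>n=1..x. mangoldt n / real n) =
      (\<Sum>n \<in> {n. n \<in> {1..x} \<and> \<not> p dvd n} \<union> {n. n \<in> {1..x} \<and> p dvd n}. mangoldt n / real n)"
    by (rule sum.cong) auto
  also have "\<dots> = principal_sum x + (\<Sum>n | n \<in> {1..x} \<and> p dvd n. mangoldt n / real n)"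
    unfolding principal_sum_def by (rule sum.union_disjoint) auto
  also have "(\<Sum>n | n \<in> {1..x} \<and> p dvd n. mangoldt n / real n) \<le> (\<Sum>n \<in> insert p {n \<in> {1..x}. \<not> prime n}. mangoldt n / real n)"
    using p by (intro sum_mono2) (auto simp: mangoldt_nonneg dest: primes_dvd_imp_eq)
  also have "\<dots> = mangoldt p / real p + (\<Sum>n \<in> {n \<in> {1..x}. \<not> prime n}. mangoldt n / real n)"
    using p by (subst sum.insert) auto
  also have "\<dots> \<le> ln (real p) / real p + 2"
    using sum_mangoldt_nonprime[of x] p by simp
  finally show ?thesis using sum_mangoldt_over[OF that] by linarith
qed

lemma L_value_one_cnj:
  assumes "0 < j" "j < p - 1" "\<And>n. chi i n = cnj (chi j n)" "0 < i" "i < p - 1"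
  shows "L_value_one (chi i) = cnj (L_value_one (chi j))"
proof -
  have "partial_L_series (chi i) = (\<lambda>x. cnj (partial_L_series (chi j) x))"
    by (simp add: partial_L_series_def fun_eq_iff assms(3))
  moreover have "(\<lambda>x. cnj (partial_L_series (chi j) x)) \<longlonglongrightarrow> cnj (L_value_one (chi j))"
    using bounded_character.partial_L_tendsto[OF bounded_character_chi[OF assms(1,2)]]
    by (rule tendsto_cnj)
  moreover have "partial_L_series (chi i) \<longlonglongrightarrow> L_value_one (chi i)"
    using bounded_character.partial_L_tendsto[OF bounded_character_chi[OF assms(4,5)]] .
  ultimately show ?thesis using LIMSEQ_unique by metis
qed

text \<open>A vanishing L(1) makes the sum behave like - ln x, which does no harm to an upper bound;
  otherwise it is bounded.\<close>

lemma Re_twisted_mangoldt_sum_bounded_above: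
  assumes "0 < j" "j < p - 1"
  shows "\<exists>C. \<forall>x\<ge>1. Re (twisted_mangoldt_sum (chi j) x) \<le> C"
proof (cases "L_value_one (chi j) = 0")
  case True
  have "Re (twisted_mangoldt_sum (chi j) x) \<le> 2 * real p" if "x \<ge> 1" for x
  proof -
    have "Re (twisted_mangoldt_sum (chi j) x + of_real (ln (real x))) \<le> 2 * real p"
      using bounded_character.mangoldt_sum_if_L_one_zero[OF bounded_character_chi[OF assms] True that]
        complex_Re_le_cmod order.trans by blast
    moreover have "ln (real x) \<ge> 0" using that by simp
    ultimately show ?thesis by simp
  qed
  then show ?thesis by blast
next
  case False
  then show ?thesis
    using bounded_character.mangoldt_sum_bounded[OF bounded_character_chi[OF assms]]
    by (meson complex_Re_le_cmod order.trans)
qed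

text \<open>The sum of all twisted sums is nonnegative, and the principal one is \<open>ln x + O(1)\<close>. A vanishing
  \<open>L(1, \<chi>)\<close> contributes \<open>- ln x\<close>, so at most one of them vanishes, which excludes the nonreal characters.\<close>

lemma L_value_one_nonzero:
  assumes j: "0 < j" "j < p - 1"
  shows "L_value_one (chi j) \<noteq> 0"
proof
  assume L0: "L_value_one (chi j) = 0"
  \<comment> \<open>Index of the conjugate character, which shares the zero; \<open>i = j\<close>
    means that the character is real.\<close>
  define i where "i = p - 1 - j"
  have i: "0 < i" "i < p - 1" "i + j = p - 1" using j by (auto simp: i_def)
  have unity_root_ij: "unity_root i * unity_root j = 1"
  proof -
    have "unity_root i * unity_root j = unity_root (i + j)"
      by (simp add: unity_root_def cis_mult add_divide_distrib algebra_simps)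
    also have "\<dots> = 1" using unity_root_period[of 0] unity_root_0 i(3) by simp
    finally show ?thesis .
  qed
  show False
  proof (cases "i = j")
    case True
    then have "unity_root j \<in> {- 1, 1}" using unity_root_ij by (simp add: power2_eq_square[symmetric] power2_eq_1_iff disj_commute)
    then have "chi j n \<in> {- 1, 0, 1}" for n
      by (cases "even (ind n)") (auto simp: chi_def)
    then show False
      using bounded_character.L_one_real_nonzero[OF bounded_character_chi[OF j]] L0 by blast
  next
    case False
    have "unity_root i = cnj (unity_root j)"
    proof -
      have "cnj (unity_root j) = inverse (unity_root j)" by (simp add: unity_root_def cis_cnj)
      then show ?thesis using unity_root_ij by (metis inverse_unique mult.commute)
    qed
    then have "chi i n = cnj (chi j n)" for n by (simp add: chi_def)
    then have Li: "L_value_one (chi i) = 0" using L_value_one_cnj[OF j _ i(1,2)] L0 by simp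
    have "\<forall>k\<in>{0<..<p - 1}. \<exists>C. \<forall>x\<ge>1. Re (twisted_mangoldt_sum (chi k) x) \<le> C"
      using Re_twisted_mangoldt_sum_bounded_above by auto
    then obtain C where C: "\<And>k x. k \<in> {0<..<p - 1} \<Longrightarrow> x \<ge> 1 \<Longrightarrow> Re (twisted_mangoldt_sum (chi k) x) \<le> C k"
      by metis
    have zero: "Re (twisted_mangoldt_sum (chi k) x) \<le> 2 * real p - ln (real x)"
      if "0 < k" "k < p - 1" "L_value_one (chi k) = 0" "x \<ge> 1" for k x
    proof -
      have "Re (twisted_mangoldt_sum (chi k) x + of_real (ln (real x))) \<le> 2 * real p"
        using bounded_character.mangoldt_sum_if_L_one_zero[OF bounded_character_chi] that
          complex_Re_le_cmod order.trans by blast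
      then show ?thesis by simp
    qed
    define D where "D = 6 + 4 * real p + (\<Sum>k \<in> {0<..<p - 1} - {i, j}. C k)"
    have "ln (real x) \<le> D" if x: "x \<ge> 1" for x
    proof -
      let ?M = "\<lambda>k. Re (twisted_mangoldt_sum (chi k) x)"
      have "(\<Sum>k<p - 1. twisted_mangoldt_sum (chi k) x) =
          of_real (real (p - 1) * (\<Sum>n | n \<in> {1..x} \<and> [n = 1] (mod p). mangoldt n / real n))"
        using sum_chi_twisted_mangoldt_sum[of 1 1 x] by (simp add: chi_one)
      then have "(\<Sum>k<p - 1. ?M k) = real (p - 1) * (\<Sum>n | n \<in> {1..x} \<and> [n = 1] (mod p). mangoldt n / real n)"
        unfolding Re_sum[symmetric] by (simp only: Re_complex_of_real)
      also have "\<dots> \<ge> 0" by (intro mult_nonneg_nonneg sum_nonneg) (auto simp: mangoldt_nonneg)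
      finally have "0 \<le> (\<Sum>k<p - 1. ?M k)" .
      also have "{..<p - 1} = insert 0 (insert i (insert j ({0<..<p - 1} - {i, j})))" using i j by auto
      also have "(\<Sum>k\<in>\<dots>. ?M k) = ?M 0 + (?M i + (?M j + (\<Sum>k\<in>{0<..<p - 1} - {i, j}. ?M k)))"
        using i j False by (simp del: insert_Diff_single)
      \<comment> \<open>The principal character gives + ln x and the two zeros give - 2 ln x, so
        nonnegativity would bound ln x.\<close>
      also have "\<dots> \<le> (ln (real x) + 6) + ((2 * real p - ln (real x)) + ((2 * real p - ln (real x))
          + (\<Sum>k\<in>{0<..<p - 1} - {i, j}. C k)))"
      proof (intro add_mono zero sum_mono i(1,2) j L0 Li x)
        show "?M 0 \<le> ln (real x) + 6"
          using principal_sum_le[OF x] by (simp add: twisted_mangoldt_sum_chi_0)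
      qed (use C x in auto)
      finally show ?thesis by (simp add: D_def)
    qed
    moreover obtain x where "x \<ge> 1" "ln (real x) > D"
    proof -
      obtain x :: nat where x: "real x > exp D" using reals_Archimedean2 by blast
      then have "real x > 0" using exp_gt_zero[of D] by linarith
      moreover from this x have "ln (real x) > D" by (metis exp_less_cancel_iff exp_ln)
      ultimately show thesis using that[of x] by simp
    qed
    ultimately show False by fastforce
  qed
qed

text \<open>In the orthogonality formula the principal character supplies ln x, and nonvanishing
  makes every other one O(1).\<close>

lemma sum_mangoldt_residue_class:
  assumes "coprime a p"
  shows "\<exists>C. \<forall>x\<ge>1. ln (real x) - C \<le> real (p - 1) * (\<Sum>n | n \<in> {1..x} \<and> [n = a] (mod p). mangoldt n / real n)"
proof -
  obtain a' where a': "[a * a' = 1] (mod p)" using cong_solve_coprime_nat[OF assms] by auto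
  then have "coprime a' p" using coprime_iff_invertible_nat[of a' p] p_gt_1 by (metis mult.commute One_nat_def)
  then have a'_p: "\<not> p dvd a'" using coprime_common_divisor[of a' p p] p_gt_1 by auto
  have "\<forall>j\<in>{0<..<p - 1}. \<exists>C. \<forall>x. norm (twisted_mangoldt_sum (chi j) x) \<le> C"
    using bounded_character.mangoldt_sum_bounded[OF bounded_character_chi] L_value_one_nonzero by auto
  then obtain C where C: "\<And>j x. j \<in> {0<..<p - 1} \<Longrightarrow> norm (twisted_mangoldt_sum (chi j) x) \<le> C j"
    by metis
  define D where "D = 8 + ln (real p) / real p + (\<Sum>j\<in>{0<..<p - 1}. C j)"
  have "ln (real x) - D \<le> real (p - 1) * (\<Sum>n | n \<in> {1..x} \<and> [n = a] (mod p). mangoldt n / real n)"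
    (is "_ \<le> ?S") if x: "x \<ge> 1" for x
  proof -
    let ?M = "\<lambda>j. chi j a' * twisted_mangoldt_sum (chi j) x"
    have "of_real ?S = (\<Sum>j<p - 1. ?M j)"
      using sum_chi_twisted_mangoldt_sum[OF a'] by simp
    also have "{..<p - 1} = insert 0 {0<..<p - 1}" using p_gt_1 by auto
    also have "(\<Sum>j\<in>\<dots>. ?M j) = of_real (principal_sum x) + (\<Sum>j\<in>{0<..<p - 1}. ?M j)"
      using a'_p by (simp add: twisted_mangoldt_sum_chi_0 chi_0)
    finally have "Re (of_real ?S) = Re (of_real (principal_sum x) + (\<Sum>j\<in>{0<..<p - 1}. ?M j))"
      by (rule arg_cong)
    then have "?S = principal_sum x + Re (\<Sum>j\<in>{0<..<p - 1}. ?M j)"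
      unfolding plus_complex.sel Re_complex_of_real .
    moreover have "norm (\<Sum>j\<in>{0<..<p - 1}. ?M j) \<le> (\<Sum>j\<in>{0<..<p - 1}. C j)"
    proof (intro sum_norm_le)
      fix j assume j: "j \<in> {0<..<p - 1}"
      have "norm (?M j) \<le> 1 * C j" unfolding norm_mult by (intro mult_mono norm_chi C j) auto
      then show "norm (?M j) \<le> C j" by simp
    qed
    ultimately show ?thesis
      using principal_sum_ge[OF x] abs_Re_le_cmod[of "\<Sum>j\<in>{0<..<p - 1}. ?M j"] by (simp add: D_def)
  qed
  then show ?thesis by blast
qed

end

text \<open>If the reciprocals converged, their tail past some \<open>v\<close> would be at most c /
  2. Bounding ln q by ln x there gives growth of only (c / 2) ln x, against the assumed c ln
  x.\<close>

lemma sum_reciprocals_unbounded: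
  fixes T :: "nat set" and c C :: real
  assumes "c > 0" and pos: "0 \<notin> T"
    and lower: "\<And>x. x \<ge> 1 \<Longrightarrow> c * ln (real x) - C \<le> (\<Sum>q | q \<in> T \<and> q \<le> x. ln (real q) / real q)"
  shows "\<exists>x. (\<Sum>q | q \<in> T \<and> y < q \<and> q \<le> x. 1 / real q) \<ge> R"
proof (rule ccontr)
  assume "\<not> ?thesis"
  then have less: "(\<Sum>q | q \<in> T \<and> y < q \<and> q \<le> x. 1 / real q) < R" for x by (simp add: not_le)
  define S where "S = (\<lambda>x. \<Sum>q | q \<in> T \<and> y < q \<and> q \<le> x. 1 / real q)"
  have mono: "S u \<le> S v" if "u \<le> v" for u v
    unfolding S_def using that by (intro sum_mono2) auto
  have bdd: "bdd_above (range S)" using less by (auto simp: S_def bdd_above_def intro: less_imp_le)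
  have "\<exists>z\<in>range S. Sup (range S) - c / 2 < z"
    using less_cSup_iff[of "range S" "Sup (range S) - c / 2"] bdd \<open>c > 0\<close> by auto
  then obtain u where u: "Sup (range S) - c / 2 < S u" by auto
  define v where "v = max u y"
  have v: "S x - S v \<le> c / 2" for x
    using cSup_upper[OF _ bdd, of "S x"] u mono[of u v] by (auto simp: v_def)
  define K where "K = (\<Sum>q | q \<in> T \<and> q \<le> v. ln (real q) / real q)"
  have "c / 2 * ln (real x) \<le> C + K" if x: "x \<ge> v" "x \<ge> 1" for x
  proof -
    have "{q. q \<in> T \<and> q \<le> x} = {q. q \<in> T \<and> q \<le> v} \<union> {q. q \<in> T \<and> v < q \<and> q \<le> x}" using x by auto
    then have "(\<Sum>q | q \<in> T \<and> q \<le> x. ln (real q) / real q) = K + (\<Sum>q | q \<in> T \<and> v < q \<and> q \<le> x. ln (real q) / real q)"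
      unfolding K_def by (simp add: sum.union_disjoint[symmetric] disjoint_iff not_le)
    also have "(\<Sum>q | q \<in> T \<and> v < q \<and> q \<le> x. ln (real q) / real q) \<le> (\<Sum>q | q \<in> T \<and> v < q \<and> q \<le> x. ln (real x) * (1 / real q))"
      by (intro sum_mono) (auto intro!: divide_right_mono)
    also have "\<dots> = ln (real x) * (\<Sum>q | q \<in> T \<and> v < q \<and> q \<le> x. 1 / real q)" by (simp add: sum_distrib_left)
    also have "(\<Sum>q | q \<in> T \<and> v < q \<and> q \<le> x. 1 / real q) = S x - S v"
    proof -
      have "{q. q \<in> T \<and> y < q \<and> q \<le> x} = {q. q \<in> T \<and> y < q \<and> q \<le> v} \<union> {q. q \<in> T \<and> v < q \<and> q \<le> x}"
        using x by (auto simp: v_def)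
      then have "S x = (\<Sum>q \<in> {q. q \<in> T \<and> y < q \<and> q \<le> v} \<union> {q. q \<in> T \<and> v < q \<and> q \<le> x}. 1 / real q)"
        by (simp add: S_def)
      also have "\<dots> = S v + (\<Sum>q | q \<in> T \<and> v < q \<and> q \<le> x. 1 / real q)"
        unfolding S_def by (rule sum.union_disjoint) auto
      finally show ?thesis by simp
    qed
    also have "ln (real x) * (S x - S v) \<le> ln (real x) * (c / 2)" using x v by (intro mult_left_mono) auto
    finally show ?thesis using lower[OF x(2)] by (simp add: algebra_simps)
  qed
  then have *: "ln (real x) \<le> 2 * (C + K) / c" if "x \<ge> v" "x \<ge> 1" for x
    using that \<open>c > 0\<close> by (simp add: field_simps)
  obtain x0 :: nat where x0: "real x0 > exp (2 * (C + K) / c)" using reals_Archimedean2 by blast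
  define x where "x = max x0 v"
  have x: "real x > exp (2 * (C + K) / c)" using x0 by (simp add: x_def)
  then have "real x > 0" using exp_gt_zero[of "2 * (C + K) / c"] by linarith
  moreover from this x have "ln (real x) > 2 * (C + K) / c" by (metis exp_less_cancel_iff exp_ln)
  ultimately show False using *[of x] by (simp add: x_def)
qed

text \<open>The cutoff \<open>y\<close> later allows a second set of primes disjoint from one
  already chosen.\<close>

theorem sum_reciprocal_primes_in_class_unbounded:
  assumes "prime p" "coprime a p"
  shows "\<exists>x. (\<Sum>q | prime q \<and> [q = a] (mod p) \<and> y < q \<and> q \<le> x. 1 / real q) \<ge> R"
proof -
  obtain g where "residue_primroot p g"
    using prime_primitive_root_exists[of p] assms(1) prime_gt_1_nat by blast
  then interpret prime_primroot p g using assms by unfold_locales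
  obtain C where C: "\<And>x. x \<ge> 1 \<Longrightarrow> ln (real x) - C \<le> real (p - 1) * (\<Sum>n | n \<in> {1..x} \<and> [n = a] (mod p). mangoldt n / real n)"
    using sum_mangoldt_residue_class[OF assms(2)] by blast
  have p1: "real (p - 1) > 0" using p_gt_1 by simp
  let ?T = "{q. prime q \<and> [q = a] (mod p)}"
  have "1 / real (p - 1) * ln (real x) - (C / real (p - 1) + 2) \<le> (\<Sum>q | q \<in> ?T \<and> q \<le> x. ln (real q) / real q)"
    if x: "x \<ge> 1" for x
  proof -
    let ?N = "{n \<in> {1..x}. \<not> prime n}"
    have "(\<Sum>n | n \<in> {1..x} \<and> [n = a] (mod p). mangoldt n / real n) \<le> (\<Sum>n \<in> {q. q \<in> ?T \<and> q \<le> x} \<union> ?N. mangoldt n / real n)"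
      by (intro sum_mono2) (auto simp: mangoldt_nonneg)
    also have "\<dots> = (\<Sum>n \<in> {q. q \<in> ?T \<and> q \<le> x}. mangoldt n / real n) + (\<Sum>n \<in> ?N. mangoldt n / real n)"
      by (intro sum.union_disjoint) auto
    also have "(\<Sum>n \<in> {q. q \<in> ?T \<and> q \<le> x}. mangoldt n / real n) = (\<Sum>q | q \<in> ?T \<and> q \<le> x. ln (real q) / real q)"
      by (intro sum.cong) auto
    finally have "(\<Sum>n | n \<in> {1..x} \<and> [n = a] (mod p). mangoldt n / real n) \<le> (\<Sum>q | q \<in> ?T \<and> q \<le> x. ln (real q) / real q) + 2"
      using sum_mangoldt_nonprime[of x] by linarith
    then have "ln (real x) - C \<le> real (p - 1) * ((\<Sum>q | q \<in> ?T \<and> q \<le> x. ln (real q) / real q) + 2)"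
      using C[OF x] p1 by (meson mult_left_mono less_imp_le order.trans)
    then have "(ln (real x) - C) / real (p - 1) \<le> (\<Sum>q | q \<in> ?T \<and> q \<le> x. ln (real q) / real q) + 2"
      using p1 by (simp only: pos_divide_le_eq mult.commute)
    then show ?thesis by (simp add: diff_divide_distrib)
  qed
  from sum_reciprocals_unbounded[OF _ _ this, where y = y and R = R] p1 show ?thesis by simp
qed

section \<open>Sieving by exact divisors\<close>

text \<open>The numbers with no exact prime divisor in \<open>Q\<close>. Exactness matters because
  only then does the prime split off a factor q^2 + q + 1 of the divisor sum of m^2.\<close>

definition not_exact_multiples :: "nat set \<Rightarrow> nat set" where
  "not_exact_multiples Q = {m. \<forall>q\<in>Q. q dvd m \<longrightarrow> q\<^sup>2 dvd m}"

definition count_upto :: "nat set \<Rightarrow> nat \<Rightarrow> nat" where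
  "count_upto S X = card {m \<in> S. 1 \<le> m \<and> m \<le> X}"

lemma count_upto_mono: "S \<subseteq> T \<Longrightarrow> count_upto S X \<le> count_upto T X"
  unfolding count_upto_def by (intro card_mono) auto

lemma count_upto_Un: "count_upto (S \<union> T) X \<le> count_upto S X + count_upto T X"
proof -
  have "{m \<in> S \<union> T. 1 \<le> m \<and> m \<le> X} = {m \<in> S. 1 \<le> m \<and> m \<le> X} \<union> {m \<in> T. 1 \<le> m \<and> m \<le> X}" by auto
  then show ?thesis unfolding count_upto_def by (simp only: card_Un_le)
qed

lemma count_not_exact_multiples_dvd:
  assumes "c > 0" and cop: "\<And>q. q \<in> Q \<Longrightarrow> coprime q c"
  shows "card {m \<in> not_exact_multiples Q. 1 \<le> m \<and> m \<le> X \<and> c dvd m} =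
    count_upto (not_exact_multiples Q) (X div c)"
proof -
  have iff: "c * k \<in> not_exact_multiples Q \<longleftrightarrow> k \<in> not_exact_multiples Q" for k
  proof -
    have "q dvd c * k \<longleftrightarrow> q dvd k" "q\<^sup>2 dvd c * k \<longleftrightarrow> q\<^sup>2 dvd k" if "q \<in> Q" for q
      using cop[OF that] by (simp_all add: coprime_dvd_mult_right_iff)
    then show ?thesis by (auto simp: not_exact_multiples_def)
  qed
  have "{m \<in> not_exact_multiples Q. 1 \<le> m \<and> m \<le> X \<and> c dvd m} =
      (*) c ` {k \<in> not_exact_multiples Q. 1 \<le> k \<and> k \<le> X div c}"
  proof (intro equalityI subsetI)
    fix m assume "m \<in> {m \<in> not_exact_multiples Q. 1 \<le> m \<and> m \<le> X \<and> c dvd m}"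
    then obtain k where k: "m = c * k" "c * k \<in> not_exact_multiples Q" "1 \<le> c * k" "c * k \<le> X" by auto
    then have "k \<le> X div c" using \<open>c > 0\<close> by (simp add: less_eq_div_iff_mult_less_eq mult.commute)
    then show "m \<in> (*) c ` {k \<in> not_exact_multiples Q. 1 \<le> k \<and> k \<le> X div c}"
      using k iff by (auto simp: Suc_le_eq)
  next
    fix m assume "m \<in> (*) c ` {k \<in> not_exact_multiples Q. 1 \<le> k \<and> k \<le> X div c}"
    then obtain k where k: "m = c * k" "k \<in> not_exact_multiples Q" "1 \<le> k" "k \<le> X div c" by auto
    then have "c * k \<le> X" using \<open>c > 0\<close> by (simp add: less_eq_div_iff_mult_less_eq mult.commute)
    then show "m \<in> {m \<in> not_exact_multiples Q. 1 \<le> m \<and> m \<le> X \<and> c dvd m}"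
      using k iff \<open>c > 0\<close> by (auto simp: Suc_le_eq)
  qed
  then show ?thesis unfolding count_upto_def using \<open>c > 0\<close>
    by (simp add: card_image inj_on_def)
qed

text \<open>Survivors for \<open>Q\<close> also survive \<open>q\<close> unless they are multiples
  of q but not of q^2; the additive form avoids truncated subtraction.\<close>

lemma count_not_exact_multiples_insert:
  assumes "prime q" "q \<notin> Q" "\<And>r. r \<in> Q \<Longrightarrow> prime r"
  shows "count_upto (not_exact_multiples (insert q Q)) X + count_upto (not_exact_multiples Q) (X div q) =
    count_upto (not_exact_multiples Q) X + count_upto (not_exact_multiples Q) (X div q\<^sup>2)"
proof -
  let ?F = "{m \<in> not_exact_multiples Q. 1 \<le> m \<and> m \<le> X}"
  have cop: "coprime r q" if "r \<in> Q" for r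
    using assms that primes_coprime by metis
  have q: "q > 0" using assms prime_gt_0_nat by blast
  have 1: "card {m \<in> ?F. q dvd m} = count_upto (not_exact_multiples Q) (X div q)"
    using count_not_exact_multiples_dvd[of q Q X] q cop by (simp add: conj_assoc)
  have 2: "card {m \<in> ?F. q\<^sup>2 dvd m} = count_upto (not_exact_multiples Q) (X div q\<^sup>2)"
    using count_not_exact_multiples_dvd[of "q\<^sup>2" Q X] q cop by (simp add: conj_assoc)
  let ?G = "{m \<in> not_exact_multiples (insert q Q). 1 \<le> m \<and> m \<le> X}"
  have "q dvd m" if "q\<^sup>2 dvd m" for m using that by (metis dvd_mult_left power2_eq_square)
  then have "?G \<union> {m \<in> ?F. q dvd m} = ?F" "?G \<inter> {m \<in> ?F. q dvd m} = {m \<in> ?F. q\<^sup>2 dvd m}"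
    by (auto simp: not_exact_multiples_def)
  then have "card ?G + card {m \<in> ?F. q dvd m} = card ?F + card {m \<in> ?F. q\<^sup>2 dvd m}"
    using card_Un_Int[of ?G "{m \<in> ?F. q dvd m}"] by simp
  then show ?thesis unfolding 1 2 by (simp add: count_upto_def)
qed

text \<open>Each inserted prime multiplies the main term by 1 - 1/q + 1/q^2, and rounding X / q and
  X / q^2 adds O(1). The error may depend on \<open>Q\<close>, which stays fixed as X grows.\<close>

lemma count_not_exact_multiples:
  assumes "finite Q" "\<And>q. q \<in> Q \<Longrightarrow> prime q"
  shows "\<exists>C. \<forall>X. \<bar>real (count_upto (not_exact_multiples Q) X) -
    (\<Prod>q\<in>Q. 1 - 1 / real q + 1 / (real q)\<^sup>2) * X\<bar> \<le> C"
  using assms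
proof (induction Q rule: finite_induct)
  case empty
  have "{m. Suc 0 \<le> m \<and> m \<le> X} = {1..X}" for X by auto
  then show ?case by (intro exI[of _ 0]) (simp add: count_upto_def not_exact_multiples_def)
next
  case (insert q Q)
  define \<delta> where "\<delta> = (\<Prod>q\<in>Q. 1 - 1 / real q + 1 / (real q)\<^sup>2)"
  define N where "N = (\<lambda>X. real (count_upto (not_exact_multiples Q) X))"
  obtain C where C: "\<And>X. \<bar>N X - \<delta> * real X\<bar> \<le> C" using insert by (auto simp: N_def \<delta>_def)
  have div: "\<bar>N (X div c) - \<delta> * (real X / real c)\<bar> \<le> C + \<bar>\<delta>\<bar>" if "c > 0" for X c
  proof -
    have "X < (X div c + 1) * c" using that dividend_less_div_times[of c X] by simp
    then have "real X < (real (X div c) + 1) * real c"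
      by (metis of_nat_less_iff of_nat_mult of_nat_add of_nat_1)
    then have "real X / real c < real (X div c) + 1" using that by (simp add: pos_divide_less_eq)
    then have "\<bar>real (X div c) - real X / real c\<bar> \<le> 1"
      using of_nat_div_le_of_nat[of X c, where 'a = real] by linarith
    then have "\<bar>\<delta>\<bar> * \<bar>real (X div c) - real X / real c\<bar> \<le> \<bar>\<delta>\<bar> * 1" by (intro mult_left_mono) auto
    then have "\<bar>\<delta> * real (X div c) - \<delta> * (real X / real c)\<bar> \<le> \<bar>\<delta>\<bar>"
      by (simp only: abs_mult[symmetric] right_diff_distrib mult_1_right)
    then show ?thesis using C[of "X div c"] by linarith
  qed
  have "\<bar>real (count_upto (not_exact_multiples (insert q Q)) X) -
      (\<Prod>q\<in>insert q Q. 1 - 1 / real q + 1 / (real q)\<^sup>2) * X\<bar> \<le> 3 * C + 2 * \<bar>\<delta>\<bar>" for X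
  proof -
    have "real (count_upto (not_exact_multiples (insert q Q)) X) + N (X div q) = N X + N (X div q\<^sup>2)"
      using count_not_exact_multiples_insert[of q Q X] insert unfolding N_def
      by (metis insertCI of_nat_add)
    moreover have "(\<Prod>q\<in>insert q Q. 1 - 1 / real q + 1 / (real q)\<^sup>2) * X =
        \<delta> * real X - \<delta> * (real X / real q) + \<delta> * (real X / real (q\<^sup>2))"
      using insert by (simp add: \<delta>_def algebra_simps)
    moreover have "q > 0" "q\<^sup>2 > 0" using insert prime_gt_0_nat by auto
    ultimately show ?thesis using C[of X] div[of q X] div[of "q\<^sup>2" X] by linarith
  qed
  then show ?case by blast
qed

text \<open>Since q \<ge> 2, the term 1/q^2 is at most half of 1/q, and 1 - u \<le> exp (- u) does
  the rest.\<close>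

lemma prod_sieve_le:
  assumes "finite Q" "\<And>q. q \<in> Q \<Longrightarrow> prime (q :: nat)"
  shows "(\<Prod>q\<in>Q. 1 - 1 / real q + 1 / (real q)\<^sup>2) \<le> exp (- (\<Sum>q\<in>Q. 1 / real q) / 2)"
proof -
  have "(\<Prod>q\<in>Q. 1 - 1 / real q + 1 / (real q)\<^sup>2) \<le> (\<Prod>q\<in>Q. exp (- (1 / real q) / 2))"
  proof (intro prod_mono conjI)
    fix q assume "q \<in> Q"
    then have q: "real q \<ge> 2" using assms prime_ge_2_nat by fastforce
    then show "0 \<le> 1 - 1 / real q + 1 / (real q)\<^sup>2" by (simp add: add_nonneg_nonneg)
    have "1 / (real q)\<^sup>2 \<le> 1 / real q / 2" using q by (simp add: power2_eq_square field_simps)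
    then have "1 - 1 / real q + 1 / (real q)\<^sup>2 \<le> 1 + (- (1 / real q) / 2)" by simp
    also have "\<dots> \<le> exp (- (1 / real q) / 2)" by (rule exp_ge_add_one_self)
    finally show "1 - 1 / real q + 1 / (real q)\<^sup>2 \<le> exp (- (1 / real q) / 2)" .
  qed
  also have "\<dots> = exp (\<Sum>q\<in>Q. - (1 / real q) / 2)" by (rule exp_sum[OF assms(1), symmetric])
  also have "(\<Sum>q\<in>Q. - (1 / real q) / 2) = - (\<Sum>q\<in>Q. 1 / real q) / 2"
    by (simp add: sum_negf sum_divide_distrib)
  finally show ?thesis .
qed

text \<open>The additive constant absorbs the bounded sieve errors; after division by X it
  disappears in the limit.\<close>

definition upper_density_le :: "nat set \<Rightarrow> real \<Rightarrow> bool" where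
  "upper_density_le S \<epsilon> \<longleftrightarrow> (\<exists>C. \<forall>X. real (count_upto S X) \<le> \<epsilon> * real X + C)"

lemma upper_density_le_Un:
  assumes "upper_density_le S \<epsilon>" "upper_density_le T \<eta>"
  shows "upper_density_le (S \<union> T) (\<epsilon> + \<eta>)"
proof -
  obtain C D where *: "\<And>X. real (count_upto S X) \<le> \<epsilon> * real X + C" "\<And>X. real (count_upto T X) \<le> \<eta> * real X + D"
    using assms unfolding upper_density_le_def by metis
  have "real (count_upto (S \<union> T) X) \<le> (\<epsilon> + \<eta>) * real X + (C + D)" for X
  proof -
    have "real (count_upto (S \<union> T) X) \<le> real (count_upto S X) + real (count_upto T X)"
      using count_upto_Un[of S T X] by linarith
    then show ?thesis using *[of X] by (simp add: algebra_simps)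
  qed
  then show ?thesis unfolding upper_density_le_def by blast
qed

lemma upper_density_le_mono:
  assumes "upper_density_le T \<epsilon>" "S \<subseteq> T"
  shows "upper_density_le S \<epsilon>"
  using assms count_upto_mono[OF assms(2)] unfolding upper_density_le_def
  by (meson of_nat_mono order.trans)

lemma upper_density_le_UN:
  assumes "finite I" "\<And>i \<eta>. i \<in> I \<Longrightarrow> \<eta> > 0 \<Longrightarrow> upper_density_le (S i) \<eta>" "\<epsilon> > 0"
  shows "upper_density_le (\<Union>i\<in>I. S i) \<epsilon>"
  using assms
proof (induction I arbitrary: \<epsilon> rule: finite_induct)
  case empty
  then show ?case by (auto simp: upper_density_le_def count_upto_def intro!: exI[of _ 0])
next
  case (insert i I)
  have "upper_density_le (S i \<union> (\<Union>i\<in>I. S i)) (\<epsilon> / 2 + \<epsilon> / 2)"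
    using insert by (intro upper_density_le_Un) auto
  then show ?case by simp
qed

lemma upper_density_not_exact_multiples:
  assumes primes: "\<And>q. q \<in> T \<Longrightarrow> prime q"
    and unbounded: "\<And>R. \<exists>x. (\<Sum>q | q \<in> T \<and> y < q \<and> q \<le> x. 1 / real q) \<ge> R"
    and "\<epsilon> > 0"
  shows "\<exists>Q. finite Q \<and> Q \<subseteq> T \<and> (\<forall>q\<in>Q. y < q) \<and> upper_density_le (not_exact_multiples Q) \<epsilon>"
proof -
  \<comment> \<open>The factor 2 undoes the halving in the exponent of
    \<open>prod_sieve_le\<close>.\<close>
  obtain x where x: "(\<Sum>q | q \<in> T \<and> y < q \<and> q \<le> x. 1 / real q) \<ge> - 2 * ln \<epsilon>" using unbounded by blast
  define Q where "Q = {q. q \<in> T \<and> y < q \<and> q \<le> x}"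
  have Q: "finite Q" "Q \<subseteq> T" "\<forall>q\<in>Q. y < q" by (auto simp: Q_def)
  then have Qp: "prime q" if "q \<in> Q" for q using primes that by auto
  define \<delta> where "\<delta> = (\<Prod>q\<in>Q. 1 - 1 / real q + 1 / (real q)\<^sup>2)"
  have "\<delta> \<le> exp (- (\<Sum>q\<in>Q. 1 / real q) / 2)" unfolding \<delta>_def by (rule prod_sieve_le[OF Q(1) Qp])
  also have "\<dots> \<le> exp (ln \<epsilon>)" using x by (simp add: Q_def)
  finally have \<delta>: "\<delta> \<le> \<epsilon>" using \<open>\<epsilon> > 0\<close> by simp
  obtain C where C: "\<And>X. \<bar>real (count_upto (not_exact_multiples Q) X) - \<delta> * X\<bar> \<le> C"
    using count_not_exact_multiples[OF Q(1) Qp] unfolding \<delta>_def by blast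
  have "real (count_upto (not_exact_multiples Q) X) \<le> \<epsilon> * real X + C" for X
    using C[of X] mult_right_mono[OF \<delta>, of "real X"] by linarith
  then show ?thesis using Q unfolding upper_density_le_def by blast
qed

lemma has_asymptotic_density_0:
  assumes "\<And>\<epsilon>. \<epsilon> > 0 \<Longrightarrow> upper_density_le S \<epsilon>"
  shows "has_asymptotic_density S 0"
  unfolding has_asymptotic_density_def
proof (rule LIMSEQ_I)
  fix e :: real assume "e > 0"
  then obtain C where C: "\<And>X. real (count_upto S X) \<le> e / 2 * real X + C"
    using assms[of "e / 2"] by (auto simp: upper_density_le_def)
  obtain N :: nat where N: "real N > 2 * C / e" using reals_Archimedean2 by blast
  show "\<exists>no. \<forall>n\<ge>no. norm (real (card {m \<in> S. 1 \<le> m \<and> m \<le> n}) / real n - 0) < e"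
  proof (intro exI[of _ "Suc N"] allI impI)
    fix n assume n: "n \<ge> Suc N"
    then have "2 * C / e < real n" using N by linarith
    then have "C < e / 2 * real n" using \<open>e > 0\<close> by (simp add: field_simps)
    then have "real (count_upto S n) < e * real n" using C[of n] by linarith
    then show "norm (real (card {m \<in> S. 1 \<le> m \<and> m \<le> n}) / real n - 0) < e"
      using n by (simp add: count_upto_def divide_less_eq)
  qed
qed

section \<open>Arithmetic of the divisor sum and conclusion\<close>

lemma divisor_sigma_prime_square: "prime q \<Longrightarrow> divisor_sigma (q\<^sup>2) = q\<^sup>2 + q + 1"
proof -
  have "{..2} = {0, 1, 2 :: nat}" by auto
  then show "prime q \<Longrightarrow> divisor_sigma (q\<^sup>2) = q\<^sup>2 + q + 1"
    using sum_divisors_prime_power[of q "\<lambda>d. d" 2] by (simp add: divisor_sigma_def)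
qed

text \<open>For a primitive root \<open>g\<close>, the power g^((p - 1) / 3) has order exactly 3, so
  \<open>p\<close> divides w^3 - 1 = (w - 1) (w^2 + w + 1) but not w - 1.\<close>

lemma cube_root_of_unity_mod_prime:
  fixes p :: nat
  assumes "prime p" "[p = 1] (mod 3)"
  obtains w where "coprime w p" "p dvd w\<^sup>2 + w + 1"
proof -
  have "p > 1" using assms prime_gt_1_nat by blast
  then obtain g where g: "residue_primroot p g" using prime_primitive_root_exists[of p] assms(1) by blast
  then have cop: "coprime p g" and ord: "ord p g = p - 1"
    using assms by (auto simp: residue_primroot_def totient_prime)
  have "3 dvd p - 1" using assms(2) \<open>p > 1\<close> by (metis cong_altdef_nat cong_sym less_imp_le)
  then obtain k where k: "p - 1 = 3 * k" by auto
  then have "k > 0" using \<open>p > 1\<close> by (cases k) auto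
  define w where "w = g ^ k"
  have w: "coprime w p" using cop by (simp add: w_def coprime_commute)
  have "[w ^ 3 = 1] (mod p)"
    using ord_divides[of g "p - 1" p] ord unfolding w_def k by (simp add: power_mult[symmetric] mult.commute)
  then have "[int w ^ 3 = 1] (mod int p)" by (metis cong_int_iff of_nat_1 of_nat_power)
  then have "int p dvd int w ^ 3 - 1" by (simp add: cong_iff_dvd_diff)
  also have "int w ^ 3 - 1 = (int w - 1) * (int w ^ 2 + int w + 1)"
    by (simp add: algebra_simps power2_eq_square power3_eq_cube)
  finally have "int p dvd int w - 1 \<or> int p dvd int w ^ 2 + int w + 1"
    using assms(1) by (simp add: prime_dvd_mult_iff)
  moreover have "\<not> int p dvd int w - 1"
  proof
    assume "int p dvd int w - 1"
    then have "[int w = int 1] (mod int p)" by (simp add: cong_iff_dvd_diff)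
    then have "[g ^ k = 1] (mod p)" unfolding cong_int_iff w_def .
    then have "3 * k dvd k" using ord_divides[of g k p] ord k by simp
    then show False using \<open>k > 0\<close> by (auto dest: dvd_imp_le)
  qed
  ultimately have "int p dvd int (w\<^sup>2 + w + 1)" by (simp add: ac_simps)
  then show thesis using that w int_dvd_int_iff by blast
qed

text \<open>Exactness lets m^2 split into coprime parts q^2, r^2 and l^2; each of the first two
  contributes one factor \<open>p\<close>.\<close>

lemma prime_square_dvd_divisor_sigma:
  assumes q: "prime q" "q dvd m" "\<not> q\<^sup>2 dvd m" and r: "prime r" "r dvd m" "\<not> r\<^sup>2 dvd m" and "q \<noteq> r"
    and p: "p dvd q\<^sup>2 + q + 1" "p dvd r\<^sup>2 + r + 1" and "m > 0"
  shows "p\<^sup>2 dvd divisor_sigma (m\<^sup>2)"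
proof -
  have "coprime q r" using q r \<open>q \<noteq> r\<close> by (simp add: primes_coprime)
  then have "q * r dvd m" using q r by (simp add: divides_mult)
  then obtain l where m: "m = q * (r * l)" by (metis dvdE mult.assoc)
  have "\<not> q dvd l" "\<not> r dvd l"
    using q(3) r(3) by (auto simp: m power2_eq_square elim!: dvdE)
  then have cop: "coprime q l" "coprime r l" using q r by (auto intro: prime_imp_coprime)
  have pos: "q > 0" "r > 0" "l > 0" using \<open>m > 0\<close> by (auto simp: m)
  have "divisor_sigma (m\<^sup>2) = divisor_sigma (q\<^sup>2 * (r\<^sup>2 * l\<^sup>2))" by (simp add: m power_mult_distrib)
  also have "\<dots> = divisor_sigma (q\<^sup>2) * (divisor_sigma (r\<^sup>2) * divisor_sigma (l\<^sup>2))"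
    using cop \<open>coprime q r\<close> pos by (simp add: divisor_sigma_mult_coprime)
  also have "p * (p * 1) dvd \<dots>"
    using p by (intro mult_dvd_mono) (auto simp: divisor_sigma_prime_square q r)
  finally show ?thesis by (simp add: power2_eq_square)
qed

theorem theorem5:
  "\<exists>\<A>::real.
     has_asymptotic_density
       {m::nat. 0 < m \<and> gcd m (divisor_sigma (m ^ 2)) = gcd (m ^ 2) (divisor_sigma (m ^ 2))} \<A>
     \<and> \<A> < 1"
proof (intro exI[of _ 0] conjI has_asymptotic_density_0)
  let ?A = "{m::nat. 0 < m \<and> gcd m (divisor_sigma (m ^ 2)) = gcd (m ^ 2) (divisor_sigma (m ^ 2))}"
  have exact: "upper_density_le {m \<in> ?A. p dvd m \<and> \<not> p\<^sup>2 dvd m} \<epsilon>"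
    if p: "prime p" "[p = 1] (mod 3)" and "\<epsilon> > 0" for p \<epsilon>
  proof -
    obtain w where w: "coprime w p" "p dvd w\<^sup>2 + w + 1" using cube_root_of_unity_mod_prime[OF p] .
    define T where "T = {q. prime q \<and> [q = w] (mod p)}"
    have T: "prime q" "p dvd q\<^sup>2 + q + 1" if "q \<in> T" for q
    proof -
      have "[q = w] (mod p)" using that by (simp add: T_def)
      then have "[q\<^sup>2 + q + 1 = w\<^sup>2 + w + 1] (mod p)" by (intro cong_add cong_pow) auto
      then show "p dvd q\<^sup>2 + q + 1" using w cong_dvd_iff by blast
    qed (use that in \<open>simp add: T_def\<close>)
    have unbounded: "\<exists>x. (\<Sum>q | q \<in> T \<and> y < q \<and> q \<le> x. 1 / real q) \<ge> R" for y R
      using sum_reciprocal_primes_in_class_unbounded[OF p(1) w(1), where y = y and R = R] by (simp add: T_def)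
    obtain Q1 where Q1: "finite Q1" "Q1 \<subseteq> T" "upper_density_le (not_exact_multiples Q1) (\<epsilon> / 2)"
      using upper_density_not_exact_multiples[OF T(1) unbounded, of "\<epsilon> / 2" 0] \<open>\<epsilon> > 0\<close> by auto
    \<comment> \<open>Starting beyond the maximum of \<open>Q1\<close> makes the two primes
      distinct; inserting 0 covers an empty \<open>Q1\<close>.\<close>
    obtain Q2 where Q2: "Q2 \<subseteq> T" "\<forall>q\<in>Q2. Max (insert 0 Q1) < q" "upper_density_le (not_exact_multiples Q2) (\<epsilon> / 2)"
      using upper_density_not_exact_multiples[OF T(1) unbounded, of "\<epsilon> / 2" "Max (insert 0 Q1)"] \<open>\<epsilon> > 0\<close> by auto
    have "{m \<in> ?A. p dvd m \<and> \<not> p\<^sup>2 dvd m} \<subseteq> not_exact_multiples Q1 \<union> not_exact_multiples Q2"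
    proof (rule subsetI, rule ccontr)
      fix m assume m: "m \<in> {m \<in> ?A. p dvd m \<and> \<not> p\<^sup>2 dvd m}"
        and "m \<notin> not_exact_multiples Q1 \<union> not_exact_multiples Q2"
      then obtain q r where q: "q \<in> Q1" "q dvd m" "\<not> q\<^sup>2 dvd m" and r: "r \<in> Q2" "r dvd m" "\<not> r\<^sup>2 dvd m"
        by (auto simp: not_exact_multiples_def)
      have "q \<le> Max (insert 0 Q1)" using q Q1(1) by simp
      then have "q \<noteq> r" using r Q2 by auto
      then have "p\<^sup>2 dvd divisor_sigma (m\<^sup>2)"
        using q r m Q1 Q2 by (intro prime_square_dvd_divisor_sigma[of q m r] T) auto
      moreover have "p\<^sup>2 dvd m\<^sup>2" using m by simp
      ultimately have "p\<^sup>2 dvd gcd (m\<^sup>2) (divisor_sigma (m\<^sup>2))" by simp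
      also have "\<dots> = gcd m (divisor_sigma (m\<^sup>2))" using m by simp
      finally have "p\<^sup>2 dvd m" by simp
      then show False using m by simp
    qed
    then show ?thesis using upper_density_le_mono upper_density_le_Un[OF Q1(3) Q2(3)] by fastforce
  qed
  fix \<epsilon> :: real assume "\<epsilon> > 0"
  let ?T = "{p. prime p \<and> [p = 1] (mod (3::nat))}"
  have "prime (3::nat)" by simp
  then have unbounded: "\<exists>x. (\<Sum>q | q \<in> ?T \<and> y < q \<and> q \<le> x. 1 / real q) \<ge> R" for y R
    using sum_reciprocal_primes_in_class_unbounded[of 3 1 R y] by simp
  obtain P where P: "finite P" "P \<subseteq> ?T" "upper_density_le (not_exact_multiples P) (\<epsilon> / 2)"
    using upper_density_not_exact_multiples[OF _ unbounded, of "\<epsilon> / 2" 0] \<open>\<epsilon> > 0\<close> by auto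
  have "upper_density_le (\<Union>p\<in>P. {m \<in> ?A. p dvd m \<and> \<not> p\<^sup>2 dvd m}) (\<epsilon> / 2)"
    using P exact \<open>\<epsilon> > 0\<close> by (intro upper_density_le_UN) auto
  from upper_density_le_Un[OF P(3) this]
  have "upper_density_le (not_exact_multiples P \<union> (\<Union>p\<in>P. {m \<in> ?A. p dvd m \<and> \<not> p\<^sup>2 dvd m})) \<epsilon>" by simp
  \<comment> \<open>An element of the set either has an exact divisor in \<open>P\<close>, and lies
    in the union, or has none and is caught by the sieve.\<close>
  then show "upper_density_le ?A \<epsilon>"
    by (rule upper_density_le_mono) (auto simp: not_exact_multiples_def)
qed simp

end
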